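(* There exist an absolute constant $C>0$ and an adaptive algorithm for the distribution 2-clustering problem in which both cluster distributions are unknown. Given $n,k,\varepsilon$ and $r=\min(|\mathcal I_1|,|\mathcal I_2|)$ (the size of the smaller cluster), it outputs the hidden partition with probability at least $2/3$, using at most $C\big(M\log k+R\big)$ samples, where $M=\max\!\left(\left(\frac{nk}{r\varepsilon^2}\right)^{2/3},\frac{k\sqrt n}{r\varepsilon^2}\right)$ and $$R=\begin{cases}\left(\frac{n^2k\log k}{\varepsilon^4}\right)^{1/3} & \text{if } n\ge\frac{k\log k}{\varepsilon^4},\\[1ex] \frac{\sqrt{nk\log k}}{\varepsilon^2} & \text{if } k\log k\le n\le\frac{k\log k}{\varepsilon^4},\\[1ex] \frac{k\log k}{\varepsilon^2} & \text{if } n\le k\log k.\end{cases}$$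
   Context: Distribution 2-clustering problem: the input is sample access (adaptive, independent samples on request) to $k\ge2$ distributions $D_1,\dots,D_k$ on $[n]$ and a parameter $\varepsilon\in(0,1]$; it is promised that there is a hidden partition $\{\mathcal I_1,\mathcal I_2\}$ of $[k]$ into two nonempty parts such that all $D_a$ with $a$ in the same part are equal, and $\mathrm{d_{TV}}(D_a,D_b)\ge\varepsilon$ whenever $a\in\mathcal I_1$, $b\in\mathcal I_2$. The goal is to output the partition. $\mathrm{d_{TV}}$ is total variation distance; sample complexity is the total number of samples drawn. *)

theory Defs
  imports "HOL-Probability.Probability"
begin

text \<open>Adaptive randomized sampling algorithms, modelled as (well-founded) decision trees.
  Distributions are indexed 0..k-1, the domain [n] is rendered as {0..<n}.
  A node either draws a fresh independent sample from distribution a and continues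
  depending on the observed value, or makes an internal random choice, or outputs
  a partition (as a set of blocks).\<close>

datatype alg =
    Output "nat set set"
  | Sample nat "nat \<Rightarrow> alg"
  | Rand "nat pmf" "nat \<Rightarrow> alg"

primrec run :: "alg \<Rightarrow> (nat \<Rightarrow> nat pmf) \<Rightarrow> nat set set pmf" where
  "run (Output P) D = return_pmf P"
| "run (Sample a f) D = bind_pmf (D a) (\<lambda>x. run (f x) D)"
| "run (Rand p f) D = bind_pmf p (\<lambda>x. run (f x) D)"

primrec samples_le :: "alg \<Rightarrow> real \<Rightarrow> bool" where
  "samples_le (Output P) m = True"
| "samples_le (Sample a f) m = (1 \<le> m \<and> (\<forall>x. samples_le (f x) (m - 1)))"
| "samples_le (Rand p f) m = (\<forall>x. samples_le (f x) m)"

definition dTV :: "nat pmf \<Rightarrow> nat pmf \<Rightarrow> real" where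
  "dTV p q = (1/2) * infsum (\<lambda>x. \<bar>pmf p x - pmf q x\<bar>) UNIV"

definition clustering_instance ::
  "nat \<Rightarrow> nat \<Rightarrow> real \<Rightarrow> (nat \<Rightarrow> nat pmf) \<Rightarrow> nat set \<Rightarrow> nat set \<Rightarrow> bool" where
  "clustering_instance n k \<epsilon> D I1 I2 \<longleftrightarrow>
     2 \<le> k \<and> 0 < \<epsilon> \<and> \<epsilon> \<le> 1 \<and>
     (\<forall>a<k. set_pmf (D a) \<subseteq> {0..<n}) \<and>
     I1 \<union> I2 = {0..<k} \<and> I1 \<inter> I2 = {} \<and> I1 \<noteq> {} \<and> I2 \<noteq> {} \<and>
     (\<forall>a\<in>I1. \<forall>b\<in>I1. D a = D b) \<and> (\<forall>a\<in>I2. \<forall>b\<in>I2. D a = D b) \<and>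
     (\<forall>a\<in>I1. \<forall>b\<in>I2. dTV (D a) (D b) \<ge> \<epsilon>)"

definition M_bound :: "nat \<Rightarrow> nat \<Rightarrow> real \<Rightarrow> nat \<Rightarrow> real" where
  "M_bound n k \<epsilon> r = max ((real n * real k / (real r * \<epsilon>^2)) powr (2/3))
                           (real k * sqrt (real n) / (real r * \<epsilon>^2))"

definition R_bound :: "nat \<Rightarrow> nat \<Rightarrow> real \<Rightarrow> real" where
  "R_bound n k \<epsilon> =
    (if real n \<ge> real k * ln (real k) / \<epsilon>^4
       then (real n ^ 2 * real k * ln (real k) / \<epsilon>^4) powr (1/3)
     else if real n \<ge> real k * ln (real k)
       then sqrt (real n * real k * ln (real k)) / \<epsilon>^2
     else real k * ln (real k) / \<epsilon>^2)"

end

theory Submission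
  imports Defs
begin

text \<open>
  Fix distributions \<open>p, q\<close> with difference \<open>d\<close>. From the counts \<open>N\<^sub>i\<close> of \<open>m \<le> n\<close> samples form the
  weights \<open>c\<^sub>i = 1 / (1 + N\<^sub>i)\<close>; they damp the heavy elements, so that with constant probability
  \<open>S = \<Sum> c\<^sub>i d\<^sub>i\<^sup>2\<close> is at least of order \<open>\<epsilon>\<^sup>2 / n\<close> while the variances of all statistics below are small.
  From \<open>s\<close> further samples of \<open>p\<close> and of \<open>q\<close> with empirical frequencies \<open>X, Y\<close> form the linear functional
  \<open>w\<^sub>i = c\<^sub>i (X\<^sub>i - Y\<^sub>i)\<close>, which satisfies \<open>E (w \<bullet> (p - q)) = S\<close>.

  Two unlike indices are found by testing \<open>D\<^sub>0\<close> against \<open>O(k/r)\<close> random indices: the weights come from one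
  batch of samples of \<open>D\<^sub>0\<close> shared by all tests, and each test averages its own \<open>w\<close> over fresh samples of
  both distributions, so that \<open>m\<close> and the number \<open>s\<close> of samples per test only need \<open>s \<surd>m \<ge> C n / \<epsilon>\<^sup>2\<close>.
  Given representatives \<open>p, q\<close> of both clusters, a single \<open>w\<close> is learned and serves as a linear
  classifier for all \<open>k\<close> distributions; with \<open>t\<close> samples per distribution it suffices that \<open>s m\<close> and \<open>t m\<close> exceed
  \<open>C n / \<epsilon>\<^sup>2\<close> and that \<open>t s m\<close> exceeds \<open>C n\<^sup>2 / \<epsilon>\<^sup>4\<close>. Only the individual tests are repeated \<open>O(log k)\<close>
  times and decided by majority, which keeps \<open>m\<close> and \<open>s\<close> free of logarithms in the second phase.
\<close>

subsection \<open>Sampling programs and finite product distributions\<close>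

text \<open>Continuation-passing style: \<open>F f\<close> draws a value from \<open>\<mu> D\<close> and goes on as \<open>f\<close>. This makes algorithms
  whose intermediate results have any type closed under sequential composition.\<close>

definition realizes :: "(('a \<Rightarrow> alg) \<Rightarrow> alg) \<Rightarrow> ((nat \<Rightarrow> nat pmf) \<Rightarrow> 'a pmf) \<Rightarrow> real \<Rightarrow> bool" where
  "realizes F \<mu> c \<longleftrightarrow>
     (\<forall>f D. run (F f) D = bind_pmf (\<mu> D) (\<lambda>x. run (f x) D)) \<and>
     (\<forall>f t. 0 \<le> t \<longrightarrow> (\<forall>x. samples_le (f x) t) \<longrightarrow> samples_le (F f) (c + t))"

text \<open>The nonnegativity of the cost makes sequential composition work: \<open>realizes\<close>
  speaks only of nonnegative continuation budgets, and the cost of the second program becomes part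
  of the budget granted to the first.\<close>

definition implementable :: "((nat \<Rightarrow> nat pmf) \<Rightarrow> 'a pmf) \<Rightarrow> real \<Rightarrow> bool" where
  "implementable \<mu> c \<longleftrightarrow> 0 \<le> c \<and> (\<exists>F. realizes F \<mu> c)"

lemma samples_le_mono: "samples_le A s \<Longrightarrow> s \<le> t \<Longrightarrow> samples_le A t"
proof (induction A arbitrary: s t)
  case (Sample a f)
  have "samples_le (f x) (t - 1)" for x
    using Sample.IH[of "f x" "s - 1" "t - 1"] Sample.prems by auto
  then show ?case using Sample.prems by auto
qed fastforce+

lemma implementable_mono: "implementable \<mu> c \<Longrightarrow> c \<le> c' \<Longrightarrow> implementable \<mu> c'"
  unfolding implementable_def realizes_def
  by (meson add_mono_thms_linordered_semiring(3) order_trans samples_le_mono)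

lemma implementable_return: "implementable (\<lambda>D. return_pmf x) 0"
  unfolding implementable_def realizes_def
  by (auto simp: bind_return_pmf intro!: exI[of _ "\<lambda>f. f x"])

lemma implementable_sample: "implementable (\<lambda>D. D a) 1"
  unfolding implementable_def realizes_def
  by (auto intro!: exI[of _ "\<lambda>f. Sample a f"])

text \<open>Internal randomness is free. \<open>Rand\<close> offers only distributions on
  \<open>nat\<close>, so a countable type travels through \<open>to_nat\<close> and is decoded in
  the continuation.\<close>

lemma implementable_rand:
  fixes p :: "'a::countable pmf"
  shows "implementable (\<lambda>D. p) 0"
  unfolding implementable_def realizes_def
  by (auto simp: bind_map_pmf intro!: exI[of _ "\<lambda>f. Rand (map_pmf to_nat p) (\<lambda>x. f (from_nat x))"])

lemma implementable_bind:
  assumes "implementable \<mu> c" "\<And>x. implementable (\<nu> x) c'"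
  shows "implementable (\<lambda>D. bind_pmf (\<mu> D) (\<lambda>x. \<nu> x D)) (c + c')"
proof -
  obtain F where F: "realizes F \<mu> c" using assms(1) by (auto simp: implementable_def)
  have "\<forall>x. \<exists>G. realizes G (\<nu> x) c'" using assms(2) by (auto simp: implementable_def)
  then obtain G where G: "\<And>x. realizes (G x) (\<nu> x) c'" by metis
  have "0 \<le> c" "0 \<le> c'" using assms by (auto simp: implementable_def)
  have "realizes (\<lambda>f. F (\<lambda>x. G x f)) (\<lambda>D. bind_pmf (\<mu> D) (\<lambda>x. \<nu> x D)) (c + c')"
    using F G \<open>0 \<le> c'\<close> unfolding realizes_def by (auto simp: bind_assoc_pmf add.assoc)
  then show ?thesis using \<open>0 \<le> c\<close> \<open>0 \<le> c'\<close> by (auto simp: implementable_def)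
qed

lemma implementable_map:
  "implementable \<mu> c \<Longrightarrow> implementable (\<lambda>D. map_pmf g (\<mu> D)) c"
  using implementable_bind[of \<mu> c "\<lambda>x D. return_pmf (g x)" 0]
  by (simp add: implementable_return map_pmf_def)

lemma implementable_replicate:
  assumes "implementable \<mu> c"
  shows "implementable (\<lambda>D. replicate_pmf m (\<mu> D)) (real m * c)"
proof (induction m)
  case 0
  then show ?case by (simp add: implementable_return)
next
  case (Suc m)
  have "implementable (\<lambda>D. bind_pmf (\<mu> D) (\<lambda>x. bind_pmf (replicate_pmf m (\<mu> D))
          (\<lambda>xs. return_pmf (x # xs)))) (c + (real m * c + 0))"
    by (intro implementable_bind assms Suc.IH implementable_return)
  then show ?case by (simp add: algebra_simps)
qed

text \<open>The analogue of \<open>replicate_pmf\<close> for independent draws whose distribution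
  varies along the list; it runs one test per index.\<close>

primrec traverse_pmf :: "('a \<Rightarrow> 'b pmf) \<Rightarrow> 'a list \<Rightarrow> 'b list pmf" where
  "traverse_pmf f [] = return_pmf []"
| "traverse_pmf f (x # xs) = bind_pmf (f x) (\<lambda>y. bind_pmf (traverse_pmf f xs) (\<lambda>ys. return_pmf (y # ys)))"

lemma implementable_traverse:
  assumes "\<And>x. implementable (\<mu> x) c"
  shows "implementable (\<lambda>D. traverse_pmf (\<lambda>x. \<mu> x D) xs) (real (length xs) * c)"
proof (induction xs)
  case Nil
  then show ?case by (simp add: implementable_return)
next
  case (Cons a xs)
  have "implementable (\<lambda>D. bind_pmf (\<mu> a D) (\<lambda>y. bind_pmf (traverse_pmf (\<lambda>x. \<mu> x D) xs)
          (\<lambda>ys. return_pmf (y # ys)))) (c + (real (length xs) * c + 0))"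
    by (intro implementable_bind assms Cons.IH implementable_return)
  then show ?case by (simp add: algebra_simps)
qed

text \<open>The continuation is closed with \<open>Output\<close>, which needs no further
  samples.\<close>

lemma implementable_imp_alg:
  assumes "implementable \<mu> c"
  obtains A where "\<And>D. run A D = \<mu> D" "samples_le A c"
proof -
  obtain F where F: "realizes F \<mu> c" using assms by (auto simp: implementable_def)
  have "run (F Output) D = \<mu> D" for D using F by (simp add: realizes_def bind_return_pmf')
  moreover have "samples_le (F Output) c" using F unfolding realizes_def
    by (metis add.right_neutral order_refl samples_le.simps(1))
  ultimately show ?thesis using that by blast
qed

text \<open>Union bound for two consecutive stages: the event \<open>B\<close> of the first stage is
  charged in full, and outside it the failure of the second stage is bounded uniformly. The error
  budgets of the algorithm are chains of such steps.\<close>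

lemma prob_bind_le:
  assumes "measure_pmf.prob p B \<le> a" "0 \<le> b"
    "\<And>x. x \<in> set_pmf p \<Longrightarrow> x \<notin> B \<Longrightarrow> measure_pmf.prob (f x) A \<le> b"
  shows "measure_pmf.prob (bind_pmf p f) A \<le> a + b"
proof -
  have "emeasure (bind_pmf p f) A = (\<integral>\<^sup>+x. emeasure (f x) A \<partial>p)" by simp
  also have "\<dots> \<le> (\<integral>\<^sup>+x. indicator B x + ennreal b \<partial>p)"
  proof (intro nn_integral_mono_AE, unfold AE_measure_pmf_iff, intro ballI)
    fix x assume x: "x \<in> set_pmf p"
    show "emeasure (f x) A \<le> indicator B x + ennreal b"
    proof (cases "x \<in> B")
      case True
      then show ?thesis
        using measure_pmf.emeasure_le_1[of "f x" A]
        by (simp add: add_increasing2)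
    next
      case False
      then show ?thesis using assms(3)[OF x False] assms(2)
        by (simp add: measure_pmf.emeasure_eq_measure ennreal_leI)
    qed
  qed
  also have "\<dots> = emeasure p B + ennreal b" by (simp add: nn_integral_add measure_pmf.emeasure_space_1)
  also have "\<dots> = ennreal (measure_pmf.prob p B + b)"
    using assms(2) by (simp add: measure_pmf.emeasure_eq_measure)
  also have "\<dots> \<le> ennreal (a + b)" using assms(1) by (intro ennreal_leI) simp
  finally show ?thesis
    using assms(2) order_trans[OF measure_nonneg assms(1)]
    by (simp add: measure_pmf.emeasure_eq_measure del: ennreal_plus)
qed

section \<open>Moments and concentration of independent samples\<close>

lemma expectation_bind_finite:
  fixes h :: "'b \<Rightarrow> real"
  assumes "finite (set_pmf p)" "\<And>x. x \<in> set_pmf p \<Longrightarrow> finite (set_pmf (f x))"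
  shows "measure_pmf.expectation (bind_pmf p f) h =
         measure_pmf.expectation p (\<lambda>x. measure_pmf.expectation (f x) h)"
  by (subst pmf_expectation_bind[OF assms(1)]) (auto simp: assms integral_measure_pmf[OF assms(1)])

lemma markov_finite_pmf:
  fixes f :: "'a \<Rightarrow> real"
  assumes "finite (set_pmf p)" "\<And>x. x \<in> set_pmf p \<Longrightarrow> 0 \<le> f x"
    "measure_pmf.expectation p f \<le> e" "0 < a"
  shows "measure_pmf.prob p {x. a \<le> f x} \<le> e / a"
proof -
  have "measure_pmf.prob p {x \<in> space p. a \<le> f x} \<le> measure_pmf.expectation p f / a"
    using assms
    by (intro integral_Markov_inequality_measure[where A="{}"])
       (auto simp: integrable_measure_pmf_finite AE_measure_pmf_iff)
  also have "\<dots> \<le> e / a" using assms by (simp add: divide_right_mono)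
  finally show ?thesis by simp
qed

lemma finite_set_replicate_pmf: "finite (set_pmf p) \<Longrightarrow> finite (set_pmf (replicate_pmf m p))"
  using finite_lists_length_eq[of "set_pmf p" m]
  by (simp add: set_replicate_pmf lists_eq_set conj_commute)

lemma length_replicate_pmf: "xs \<in> set_pmf (replicate_pmf m p) \<Longrightarrow> length xs = m"
  by (simp add: set_replicate_pmf)

lemma expectation_replicate_Suc:
  fixes h :: "'a list \<Rightarrow> real"
  assumes "finite (set_pmf p)"
  shows "measure_pmf.expectation (replicate_pmf (Suc m) p) h =
    measure_pmf.expectation p (\<lambda>x. measure_pmf.expectation (replicate_pmf m p) (\<lambda>xs. h (x # xs)))"
proof -
  have "replicate_pmf (Suc m) p = bind_pmf p (\<lambda>x. map_pmf (\<lambda>xs. x # xs) (replicate_pmf m p))"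
    by (simp add: map_pmf_def)
  then show ?thesis
    by (simp only:) (subst expectation_bind_finite, auto simp: assms finite_set_replicate_pmf)
qed

lemma expectation_sum_list:
  fixes f :: "'a \<Rightarrow> real"
  assumes fin: "finite (set_pmf p)"
  shows "measure_pmf.expectation (replicate_pmf m p) (\<lambda>xs. \<Sum>x\<leftarrow>xs. f x) = real m * measure_pmf.expectation p f"
proof (induction m)
  case (Suc m)
  have int: "integrable (measure_pmf q) (g :: _ \<Rightarrow> real)" if "finite (set_pmf q)" for q g
    using that by (rule integrable_measure_pmf_finite)
  show ?case
    by (subst expectation_replicate_Suc[OF fin])
       (simp add: int fin finite_set_replicate_pmf Suc.IH algebra_simps)
qed simp

text \<open>Expanding the square one sample at a time, the cross terms vanish because the mean is
  zero.\<close>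

lemma expectation_sum_list_sq:
  fixes f :: "'a \<Rightarrow> real"
  assumes fin: "finite (set_pmf p)" and mean: "measure_pmf.expectation p f = 0"
  shows "measure_pmf.expectation (replicate_pmf m p) (\<lambda>xs. (\<Sum>x\<leftarrow>xs. f x)\<^sup>2) =
         real m * measure_pmf.expectation p (\<lambda>x. (f x)\<^sup>2)"
proof (induction m)
  case (Suc m)
  have int: "integrable (measure_pmf q) (g :: _ \<Rightarrow> real)" if "finite (set_pmf q)" for q g
    using that by (rule integrable_measure_pmf_finite)
  show ?case
    by (subst expectation_replicate_Suc[OF fin])
       (simp add: int fin finite_set_replicate_pmf Suc.IH algebra_simps power2_sum
         expectation_sum_list[OF fin] mean)
qed simp

definition avg :: "('a \<Rightarrow> real) \<Rightarrow> 'a list \<Rightarrow> real" where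
  "avg f xs = (\<Sum>x\<leftarrow>xs. f x) / real (length xs)"

text \<open>Centering \<open>f\<close> reduces this to \<open>expectation_sum_list_sq\<close>. The
  second moment replaces the variance because it is what the later energy bounds control.\<close>

lemma avg_variance:
  fixes f :: "'a \<Rightarrow> real"
  assumes fin: "finite (set_pmf p)" and "0 < s"
  shows "measure_pmf.expectation (replicate_pmf s p)
           (\<lambda>xs. (avg f xs - measure_pmf.expectation p f)\<^sup>2)
         \<le> measure_pmf.expectation p (\<lambda>x. (f x)\<^sup>2) / real s"
proof -
  define \<mu> where "\<mu> = measure_pmf.expectation p f"
  define g where "g = (\<lambda>x. f x - \<mu>)"
  have int: "integrable (measure_pmf p) (g :: _ \<Rightarrow> real)" for g
    using fin by (rule integrable_measure_pmf_finite)
  have g0: "measure_pmf.expectation p g = 0"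
    by (simp add: g_def int \<mu>_def)
  have sl: "(\<Sum>x\<leftarrow>xs. g x) = (\<Sum>x\<leftarrow>xs. f x) - real (length xs) * \<mu>" for xs
    by (induction xs) (auto simp: g_def algebra_simps)
  have "(avg f xs - \<mu>)\<^sup>2 = (\<Sum>x\<leftarrow>xs. g x)\<^sup>2 / (real s)\<^sup>2" if "length xs = s" for xs
    using that \<open>0 < s\<close> by (simp add: avg_def sl power_divide[symmetric] diff_divide_distrib)
  then have "measure_pmf.expectation (replicate_pmf s p) (\<lambda>xs. (avg f xs - \<mu>)\<^sup>2) =
    measure_pmf.expectation (replicate_pmf s p) (\<lambda>xs. (\<Sum>x\<leftarrow>xs. g x)\<^sup>2 / (real s)\<^sup>2)"
    by (intro integral_cong_AE) (auto simp: AE_measure_pmf_iff dest: length_replicate_pmf)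
  also have "\<dots> = measure_pmf.expectation p (\<lambda>x. (g x)\<^sup>2) / real s"
    using \<open>0 < s\<close> by (simp add: expectation_sum_list_sq[OF fin g0]) (simp add: power2_eq_square)
  also have "measure_pmf.expectation p (\<lambda>x. (g x)\<^sup>2) = measure_pmf.expectation p (\<lambda>x. (f x)\<^sup>2) - \<mu>\<^sup>2"
    by (simp add: g_def power2_diff int \<mu>_def[symmetric] algebra_simps power2_eq_square)
  finally show ?thesis using \<open>0 < s\<close> by (simp add: \<mu>_def divide_right_mono)
qed

lemma avg_chebyshev:
  fixes f :: "'a \<Rightarrow> real"
  assumes fin: "finite (set_pmf p)" and "0 < s" "0 < t"
  shows "measure_pmf.prob (replicate_pmf s p) {xs. t \<le> \<bar>avg f xs - measure_pmf.expectation p f\<bar>}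
         \<le> measure_pmf.expectation p (\<lambda>x. (f x)\<^sup>2) / (real s * t\<^sup>2)"
proof -
  have eq: "(t \<le> \<bar>y\<bar>) = (t\<^sup>2 \<le> y\<^sup>2)" for y :: real
    using \<open>0 < t\<close> by (metis abs_le_square_iff abs_of_pos)
  show ?thesis
    using markov_finite_pmf[OF finite_set_replicate_pmf[OF fin] _ avg_variance[OF fin \<open>0 < s\<close>, of f], of "t\<^sup>2"] \<open>0 < t\<close>
    by (simp add: eq)
qed

text \<open>Markov's inequality for \<open>16\<close> to the number of wrong votes.\<close>

lemma prob_majority_error:
  fixes p :: "bool pmf"
  assumes "measure_pmf.prob p {b. b \<noteq> v} \<le> 1/16"
  shows "measure_pmf.prob (map_pmf (\<lambda>bs. 2 * count_list bs True > length bs) (replicate_pmf L p)) {b. b \<noteq> v} \<le> 1 / 2 ^ L"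
proof -
  define err :: "bool \<Rightarrow> real" where "err = (\<lambda>b. if b \<noteq> v then 16 else 1)"
  have fin: "finite (set_pmf q)" for q :: "bool pmf" by simp
  have "measure_pmf.expectation p err = measure_pmf.expectation p (\<lambda>b. 1 + 15 * indicator {b. b \<noteq> v} b)"
    by (rule arg_cong[where f="\<lambda>f. measure_pmf.expectation p f"]) (auto simp: err_def fun_eq_iff)
  also have "\<dots> = 1 + 15 * measure_pmf.prob p {b. b \<noteq> v}"
    by (subst Bochner_Integration.integral_add) (auto intro: integrable_measure_pmf_finite)
  finally have e2: "measure_pmf.expectation p err \<le> 2" using assms by simp
  have pos: "0 \<le> measure_pmf.expectation p err"
    by (rule Bochner_Integration.integral_nonneg) (simp add: err_def)
  have "measure_pmf.expectation (replicate_pmf L p) (\<lambda>bs. prod_list (map err bs)) \<le> 2 ^ L"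
  proof (induction L)
    case (Suc L)
    have "measure_pmf.expectation (replicate_pmf (Suc L) p) (\<lambda>bs. prod_list (map err bs)) =
      measure_pmf.expectation p err * measure_pmf.expectation (replicate_pmf L p) (\<lambda>bs. prod_list (map err bs))"
      by (subst expectation_replicate_Suc) simp_all
    also have "\<dots> \<le> 2 * 2 ^ L" 
      using e2 pos Suc by (intro mult_mono) (auto intro!: Bochner_Integration.integral_nonneg prod_list_nonneg simp: err_def)
    finally show ?case by simp
  qed simp
  then have m: "measure_pmf.prob (replicate_pmf L p) {bs. 4 ^ L \<le> prod_list (map err bs)} \<le> 2 ^ L / 4 ^ L"
    by (intro markov_finite_pmf finite_set_replicate_pmf) (auto intro!: prod_list_nonneg simp: err_def)
  have pl: "prod_list (map err bs) = 16 ^ count_list bs (\<not> v)" for bs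
    by (induction bs) (auto simp: err_def)
  have cl: "count_list bs True + count_list bs False = length bs" for bs
    by (induction bs) auto
  have "measure_pmf.prob (map_pmf (\<lambda>bs. 2 * count_list bs True > length bs) (replicate_pmf L p)) {b. b \<noteq> v}
     = measure_pmf.prob (replicate_pmf L p) {bs. (2 * count_list bs True > length bs) \<noteq> v}"
    by (simp add: vimage_def)
  also have "\<dots> = measure_pmf.prob (replicate_pmf L p) ({bs. (2 * count_list bs True > length bs) \<noteq> v} \<inter> set_pmf (replicate_pmf L p))"
    by (simp add: measure_Int_set_pmf)
  also have "\<dots> \<le> measure_pmf.prob (replicate_pmf L p) {bs. 4 ^ L \<le> prod_list (map err bs)}"
  proof (intro measure_pmf.finite_measure_mono subsetI, unfold mem_Collect_eq Int_iff, elim conjE)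
    fix bs assume b: "(2 * count_list bs True > length bs) \<noteq> v" "bs \<in> set_pmf (replicate_pmf L p)"
    then have "length bs = L" by (simp add: length_replicate_pmf)
    \<comment> \<open>The result \<open>True\<close> needs a strict majority, so a tie counts as
      \<open>False\<close>; for either value of \<open>v\<close> a wrong result still means that at
      least half of the votes are wrong.\<close>
    then have "L \<le> 2 * count_list bs (\<not> v)" using b(1) cl[of bs] by (cases v) auto
    then have "(4::real) ^ L \<le> 4 ^ (2 * count_list bs (\<not> v))" by (intro power_increasing) auto
    then show "4 ^ L \<le> prod_list (map err bs)" by (simp add: pl power_mult)
  qed simp
  also note m
  also have "(2::real) ^ L / 4 ^ L = 1 / 2 ^ L"
    by (metis (no_types, lifting) div_by_1 divide_divide_eq_left mult_2 numeral_Bit0 power_divide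
        power_one one_add_one nonzero_divide_mult_cancel_left mult.commute divide_self_if
        zero_neq_numeral mult.right_neutral numeral_One)
  finally show ?thesis .
qed

text \<open>Union bound over the entries of the list, by iterating
  \<open>prob_bind_le\<close>.\<close>

lemma prob_traverse_error:
  assumes "\<And>x. x \<in> set xs \<Longrightarrow> measure_pmf.prob (f x) {y. \<not> G x y} \<le> \<delta>" "0 \<le> \<delta>"
  shows "measure_pmf.prob (traverse_pmf f xs) {ys. \<not> list_all2 G xs ys} \<le> real (length xs) * \<delta>"
  using assms(1)
proof (induction xs)
  case (Cons a xs)
  have IH: "measure_pmf.prob (traverse_pmf f xs) {ys. \<not> list_all2 G xs ys} \<le> real (length xs) * \<delta>"
    using Cons by auto
  have "measure_pmf.prob (traverse_pmf f (a # xs)) {ys. \<not> list_all2 G (a # xs) ys} \<le> \<delta> + (real (length xs) * \<delta> + 0)"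
    unfolding traverse_pmf.simps
  proof (rule prob_bind_le[OF Cons.prems])
    fix y assume "y \<notin> {y. \<not> G a y}"
    then show "measure_pmf.prob (bind_pmf (traverse_pmf f xs) (\<lambda>ys. return_pmf (y # ys)))
        {ys. \<not> list_all2 G (a # xs) ys} \<le> real (length xs) * \<delta> + 0"
      by (intro prob_bind_le[OF IH]) auto
  qed (use assms(2) in auto)
  then show ?case by (simp add: algebra_simps)
qed (simp add: indicator_def)

subsection \<open>Flattening weights\<close>

lemma prob_pair_le:
  assumes "measure_pmf.prob A P \<le> a" "measure_pmf.prob B Q \<le> b"
  shows "measure_pmf.prob (pair_pmf A B) {z. fst z \<in> P \<or> snd z \<in> Q} \<le> a + b"
proof -
  have "measure_pmf.prob (pair_pmf A B) {z. fst z \<in> P \<or> snd z \<in> Q} =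
        measure_pmf.prob (pair_pmf A B) ((fst -` P) \<union> (snd -` Q))"
    by (rule arg_cong[where f="measure_pmf.prob _"]) auto
  also have "\<dots> \<le> measure_pmf.prob (pair_pmf A B) (fst -` P) + measure_pmf.prob (pair_pmf A B) (snd -` Q)"
    by (rule measure_Un_le) auto
  also have "\<dots> = measure_pmf.prob (map_pmf fst (pair_pmf A B)) P + measure_pmf.prob (map_pmf snd (pair_pmf A B)) Q"
    by simp
  also have "\<dots> \<le> a + b" using assms by (simp only: map_fst_pair_pmf map_snd_pair_pmf add_mono)
  finally show ?thesis .
qed

lemma prob_Un_le:
  assumes "measure_pmf.prob A P \<le> a" "measure_pmf.prob A Q \<le> b"
  shows "measure_pmf.prob A (P \<union> Q) \<le> a + b"
  using measure_Un_le[of P A Q] assms by simp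

lemma prob_mono:
  "P \<inter> set_pmf A \<subseteq> Q \<Longrightarrow> measure_pmf.prob A P \<le> measure_pmf.prob A Q"
  by (metis measure_Int_set_pmf measure_pmf.finite_measure_mono sets_measure_pmf UNIV_I sets_UNIV)

lemma expectation_pair_fst:
  "measure_pmf.expectation (pair_pmf A B) (\<lambda>z. f (fst z) :: real) = measure_pmf.expectation A f"
  using integral_map_pmf[of fst "pair_pmf A B" f] by (simp add: map_fst_pair_pmf)

lemma expectation_pair_snd:
  "measure_pmf.expectation (pair_pmf A B) (\<lambda>z. f (snd z) :: real) = measure_pmf.expectation B f"
  using integral_map_pmf[of snd "pair_pmf A B" f] by (simp add: map_snd_pair_pmf)

lemma expectation_lessThan:
  fixes p :: "nat pmf"
  assumes "set_pmf p \<subseteq> {..<n}"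
  shows "measure_pmf.expectation p f = (\<Sum>i<n. pmf p i * f i :: real)"
  using assms by (subst integral_measure_pmf[of "{..<n}"]) auto

lemma sum_pmf_lessThan:
  fixes p :: "nat pmf"
  assumes "set_pmf p \<subseteq> {..<n}"
  shows "(\<Sum>i<n. pmf p i) = 1"
  using assms by (intro sum_pmf_eq_1) auto

section \<open>Empirical frequencies and moments of counts\<close>

definition freq :: "'a list \<Rightarrow> 'a \<Rightarrow> real" where
  "freq xs i = avg (\<lambda>x. of_bool (x = i)) xs"

definition flat_weight :: "nat list \<Rightarrow> nat \<Rightarrow> real" where
  "flat_weight u i = 1 / (1 + real (count_list u i))"

definition wt :: "(nat \<Rightarrow> real) \<Rightarrow> nat list \<Rightarrow> nat list \<Rightarrow> nat \<Rightarrow> real" where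
  "wt c X Y i = c i * (freq X i - freq Y i)"

lemma count_list_sum: "real (count_list xs i) = (\<Sum>x\<leftarrow>xs. of_bool (x = i))"
  by (induction xs) auto

lemma expectation_of_bool_eq:
  "measure_pmf.expectation p (\<lambda>x. of_bool (x = i) :: real) = pmf p i"
  by (subst integral_measure_pmf_real[of "{i}"]) auto

text \<open>Exchanging the order of summation turns a linear functional of the empirical frequencies
  into a sample average, to which the variance bound for \<open>avg\<close> applies.\<close>

lemma avg_freq:
  fixes xs :: "nat list"
  assumes "set xs \<subseteq> {..<n}"
  shows "avg f xs = (\<Sum>i<n. f i * freq xs i)"
proof -
  have "(\<Sum>x\<leftarrow>xs. f x) = (\<Sum>i<n. f i * (\<Sum>x\<leftarrow>xs. of_bool (x = i)))"
    using assms
  proof (induction xs)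
    case (Cons a xs)
    have "(\<Sum>i<n. f i * (\<Sum>x\<leftarrow>a # xs. of_bool (x = i))) = (\<Sum>i<n. f i * of_bool (a = i)) + (\<Sum>i<n. f i * (\<Sum>x\<leftarrow>xs. of_bool (x = i)))"
      by (simp add: algebra_simps sum.distrib)
    also have "(\<Sum>i<n. f i * of_bool (a = i)) = (\<Sum>i<n. if a = i then f i else 0)"
      by (intro sum.cong) auto
    also have "\<dots> = f a" using Cons.prems by simp
    finally show ?case using Cons by simp
  qed simp
  then show ?thesis by (simp add: avg_def freq_def sum_divide_distrib)
qed

lemma freq_variance:
  fixes p :: "nat pmf"
  assumes "set_pmf p \<subseteq> {..<n}" "0 < s"
  shows "measure_pmf.expectation (replicate_pmf s p) (\<lambda>xs. (freq xs i - pmf p i)\<^sup>2) \<le> pmf p i / real s"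
proof -
  have fin: "finite (set_pmf p)" using assms(1) finite_subset by blast
  have sq: "((of_bool b)::real)\<^sup>2 = of_bool b" for b by simp
  show ?thesis using avg_variance[OF fin assms(2), of "\<lambda>x. of_bool (x = i)"]
    by (simp add: freq_def expectation_of_bool_eq sq)
qed

text \<open>Each sample hits \<open>i\<close> independently with probability \<open>pmf h i\<close>.
  This reduces moments of a single count to the binomial law.\<close>

lemma count_list_binomial:
  "map_pmf (\<lambda>u. count_list u i) (replicate_pmf m h) = binomial_pmf m (pmf h i)"
proof (induction m)
  case 0
  then show ?case by (simp add: binomial_pmf_0 pmf_le_1)
next
  case (Suc m)
  have b: "map_pmf (\<lambda>x. x = i) h = bernoulli_pmf (pmf h i)"
  proof (rule pmf_eqI)
    fix b
    have "pmf (map_pmf (\<lambda>x. x = i) h) True = pmf h i"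
      by (simp add: pmf_map vimage_def measure_pmf_single)
    moreover have "pmf (map_pmf (\<lambda>x. x = i) h) False = 1 - pmf (map_pmf (\<lambda>x. x = i) h) True"
      using pmf_False_conv_True by blast
    ultimately show "pmf (map_pmf (\<lambda>x. x = i) h) b = pmf (bernoulli_pmf (pmf h i)) b"
      by (cases b) (auto simp: pmf_le_1)
  qed
  have "map_pmf (\<lambda>u. count_list u i) (replicate_pmf (Suc m) h) =
     bind_pmf (map_pmf (\<lambda>x. x = i) h) (\<lambda>b. bind_pmf (map_pmf (\<lambda>u. count_list u i) (replicate_pmf m h))
       (\<lambda>k. return_pmf ((if b then 1 else 0) + k)))"
    by (auto simp: map_pmf_def bind_assoc_pmf bind_return_pmf intro!: bind_pmf_cong)
  then show ?case by (simp add: b Suc.IH binomial_pmf_Suc pmf_le_1)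
qed

lemma expectation_count_list:
  fixes h :: "nat pmf"
  assumes "finite (set_pmf h)"
  shows "measure_pmf.expectation (replicate_pmf m h) (\<lambda>u. real (count_list u i)) = real m * pmf h i"
proof -
  show ?thesis by (simp add: count_list_sum expectation_sum_list[OF assms] expectation_of_bool_eq)
qed

text \<open>The fraction is absorbed into the binomial coefficient, turning
  \<open>m choose k\<close> into a multiple of \<open>(m + 2) choose (k + 2)\<close>. The
  expectation times \<open>(m + 1) (m + 2) p\<^sup>2\<close> is thus a part of the binomial
  expansion of \<open>(p + (1 - p)) ^ (m + 2)\<close>.\<close>

lemma binomial_inverse_moment:
  fixes p :: real
  assumes "0 \<le> p" "p \<le> 1"
  shows "measure_pmf.expectation (binomial_pmf m p) (\<lambda>k. 1 / (real (k + 1) * real (k + 2))) * (real m * p)\<^sup>2 \<le> 1"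
proof -
  let ?b = "\<lambda>k. real ((m + 2) choose k) * p ^ k * (1 - p) ^ (m + 2 - k)"
  have *: "real (m choose k) * p ^ k * (1 - p) ^ (m - k) * (1 / (real (k + 1) * real (k + 2))) * ((real m + 1) * (real m + 2) * p\<^sup>2)
        = ?b (k + 2)" for k
  proof -
    have "real (Suc k * (Suc m choose Suc k)) = real (Suc m * (m choose k))"
      by (simp only: Suc_times_binomial)
    then have 1: "(real k + 1) * real (Suc m choose Suc k) = (real m + 1) * real (m choose k)"
      by (simp only: of_nat_mult of_nat_Suc add.commute)
    have "real (Suc (Suc k) * (Suc (Suc m) choose Suc (Suc k))) = real (Suc (Suc m) * (Suc m choose Suc k))"
      by (simp only: Suc_times_binomial)
    then have 2: "(real k + 2) * real ((m + 2) choose (k + 2)) = (real m + 2) * real (Suc m choose Suc k)"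
      by (simp only: of_nat_mult of_nat_Suc add_2_eq_Suc') (simp add: add.commute)
    have "(real k + 1) * (real k + 2) * real ((m + 2) choose (k + 2)) = (real k + 1) * ((real k + 2) * real ((m + 2) choose (k + 2)))"
      by (simp only: mult.assoc)
    also have "\<dots> = (real m + 2) * ((real k + 1) * real (Suc m choose Suc k))"
      unfolding 2 by (simp only: mult.left_commute)
    finally have "(real k + 1) * (real k + 2) * real ((m + 2) choose (k + 2)) = (real m + 1) * (real m + 2) * real (m choose k)"
      unfolding 1 by (simp only: mult_ac)
    moreover have "(real k + 1) * (real k + 2) \<noteq> 0" by (simp add: add_eq_0_iff)
    ultimately have "real ((m + 2) choose (k + 2)) = (real m + 1) * (real m + 2) * real (m choose k) / ((real k + 1) * (real k + 2))"
      by (metis nonzero_mult_div_cancel_left)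
    moreover have "m + 2 - (k + 2) = m - k" by simp
    ultimately show ?thesis unfolding power_add of_nat_add by (simp add: mult_ac)
  qed
  have "measure_pmf.expectation (binomial_pmf m p) (\<lambda>k. 1 / (real (k + 1) * real (k + 2)))
     = (\<Sum>k\<le>m. real (m choose k) * p ^ k * (1 - p) ^ (m - k) * (1 / (real (k + 1) * real (k + 2))))"
    using assms by (subst expectation_binomial_pmf') (simp_all only: real_scaleR_def atLeastAtMost_iff simp_thms)
  then have "measure_pmf.expectation (binomial_pmf m p) (\<lambda>k. 1 / (real (k + 1) * real (k + 2))) * ((real m + 1) * (real m + 2) * p\<^sup>2)
     = (\<Sum>k\<le>m. ?b (k + 2))"
    by (simp only: sum_distrib_right *)
  also have "\<dots> = (\<Sum>k\<in>(\<lambda>k. k + 2) ` {..m}. ?b k)"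
    by (subst sum.reindex) (simp_all only: o_def inj_on_def, simp)
  \<comment> \<open>The terms for \<open>0\<close> and \<open>1\<close>, which the shift misses, are
    nonnegative.\<close>
  also have "\<dots> \<le> (\<Sum>k\<le>m + 2. ?b k)"
    using assms by (intro sum_mono2 mult_nonneg_nonneg zero_le_power) (auto simp del: binomial_Suc_Suc)
  also have "\<dots> = (p + (1 - p)) ^ (m + 2)" by (simp only: binomial_ring)
  finally have 1: "measure_pmf.expectation (binomial_pmf m p) (\<lambda>k. 1 / (real (k + 1) * real (k + 2))) * ((real m + 1) * (real m + 2) * p\<^sup>2) \<le> 1"
    by simp
  have "measure_pmf.expectation (binomial_pmf m p) (\<lambda>k. 1 / (real (k + 1) * real (k + 2))) * (real m * p)\<^sup>2 \<le>
     measure_pmf.expectation (binomial_pmf m p) (\<lambda>k. 1 / (real (k + 1) * real (k + 2))) * ((real m + 1) * (real m + 2) * p\<^sup>2)"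
  proof (intro mult_left_mono Bochner_Integration.integral_nonneg)
    have "real m * real m \<le> (real m + 1) * (real m + 2)" by (intro mult_mono) auto
    then have "(real m)\<^sup>2 * p\<^sup>2 \<le> (real m + 1) * (real m + 2) * p\<^sup>2"
      by (intro mult_right_mono) (auto simp: power2_eq_square)
    then show "(real m * p)\<^sup>2 \<le> (real m + 1) * (real m + 2) * p\<^sup>2" by (simp add: power_mult_distrib)
  qed simp
  with 1 show ?thesis by linarith
qed

lemma flat_weight_range: "0 < flat_weight u i" "flat_weight u i \<le> 1"
  by (auto simp: flat_weight_def add_pos_nonneg)

text \<open>Up to a constant, the squared weight behaves as if the count equalled its mean. Two
  bounds are combined: \<open>e \<le> 1\<close>, and \<open>e * a\<^sup>2 \<le> 2\<close> from the
  inverse moment.\<close>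

lemma expectation_flat_weight_sq:
  fixes h :: "nat pmf"
  assumes fin: "finite (set_pmf h)"
  shows "measure_pmf.expectation (replicate_pmf m h) (\<lambda>u. (flat_weight u i)\<^sup>2) \<le> 8 / (1 + real m * pmf h i)\<^sup>2"
proof -
  define e where "e = measure_pmf.expectation (replicate_pmf m h) (\<lambda>u. (flat_weight u i)\<^sup>2)"
  define b where "b = measure_pmf.expectation (binomial_pmf m (pmf h i)) (\<lambda>k. 1 / (real (k + 1) * real (k + 2)))"
  define a where "a = real m * pmf h i"
  have a0: "a \<ge> 0" by (simp add: a_def)
  note int = integrable_measure_pmf_finite[OF finite_set_replicate_pmf[OF fin]]
  have "e \<le> measure_pmf.expectation (replicate_pmf m h) (\<lambda>u. 1)"
    unfolding e_def
    by (intro integral_mono int) (simp add: power_le_one flat_weight_range less_imp_le)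
  then have e1: "e \<le> 1" by simp
  have "b = measure_pmf.expectation (replicate_pmf m h) (\<lambda>u. 1 / (real (count_list u i + 1) * real (count_list u i + 2)))"
    unfolding b_def count_list_binomial[symmetric] by simp
  then have 2: "2 * b = measure_pmf.expectation (replicate_pmf m h) (\<lambda>u. 2 * (1 / (real (count_list u i + 1) * real (count_list u i + 2))))"
    by (simp only: integral_mult_right_zero)
  have e2b: "e \<le> 2 * b"
    unfolding 2 e_def
  proof (intro integral_mono int)
    fix u
    \<comment> \<open>Valid because \<open>x + 2 \<le> 2 * (x + 1)\<close>.\<close>
    have "1 / (1 + x)\<^sup>2 \<le> 2 * (1 / ((x + 1) * (x + 2)))" if "0 \<le> x" for x :: real
      using that by (simp add: divide_simps power2_eq_square) (simp add: algebra_simps)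
    from this[of "real (count_list u i)"]
    show "(flat_weight u i)\<^sup>2 \<le> 2 * (1 / (real (count_list u i + 1) * real (count_list u i + 2)))"
      by (simp add: flat_weight_def power_divide add.commute)
  qed
  have "b * a\<^sup>2 \<le> 1"
    unfolding a_def b_def by (rule binomial_inverse_moment) (auto simp: pmf_le_1)
  with mult_right_mono[OF e2b zero_le_power2[of a]] have e2: "e * a\<^sup>2 \<le> 2" by simp
  have "e * (1 + a)\<^sup>2 \<le> 8"
  \<comment> \<open>For \<open>a \<le> 1\<close> the trivial bound gives \<open>4\<close>; for
    larger \<open>a\<close> one has \<open>1 + a \<le> 2 * a\<close>, and the inverse moment gives
    \<open>4 * 2\<close>.\<close>
  proof (cases "a \<le> 1")
    case True
    have "e \<ge> 0" unfolding e_def by (rule Bochner_Integration.integral_nonneg) simp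
    have "(1 + a)\<^sup>2 \<le> 2\<^sup>2" using True a0 by (intro power_mono) auto
    then have "e * (1 + a)\<^sup>2 \<le> 1 * 4" using e1 \<open>e \<ge> 0\<close> by (intro mult_mono) auto
    then show ?thesis by simp
  next
    case False
    have "e \<ge> 0" unfolding e_def by (rule Bochner_Integration.integral_nonneg) simp
    have "(1 + a)\<^sup>2 \<le> (2 * a)\<^sup>2" using False a0 by (intro power_mono) auto
    then have "e * (1 + a)\<^sup>2 \<le> e * (2 * a)\<^sup>2" using \<open>e \<ge> 0\<close> by (intro mult_left_mono)
    also have "\<dots> = 4 * (e * a\<^sup>2)" by (simp add: power_mult_distrib)
    finally show ?thesis using e2 by simp
  qed
  then show ?thesis using a0
    by (simp add: e_def[symmetric] a_def[symmetric] pos_le_divide_eq add_pos_nonneg)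
qed

text \<open>Here \<open>h\<close> is the distribution whose samples produce the weights,
  \<open>d\<close> the difference to be detected and \<open>S\<close> the signal. The other two sums
  are noise terms: the linear one is bounded relative to \<open>S\<close>, whose size is not known
  in advance, the quadratic one absolutely.\<close>

definition good_flat :: "nat \<Rightarrow> nat \<Rightarrow> real \<Rightarrow> nat pmf \<Rightarrow> (nat \<Rightarrow> real) \<Rightarrow> (nat \<Rightarrow> real) \<Rightarrow> bool" where
  "good_flat n m \<epsilon> h d c \<longleftrightarrow>
     (let S = (\<Sum>i<n. c i * (d i)\<^sup>2) in
       \<epsilon>\<^sup>2 / (25 * real n) \<le> S \<and>
       (\<Sum>i<n. pmf h i * ((c i)\<^sup>2 * (d i)\<^sup>2)) \<le> 20000 * S / real m \<and>
       (\<Sum>i<n. (pmf h i)\<^sup>2 * (c i)\<^sup>2) \<le> 400 / real m)"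

text \<open>With \<open>c\<close> replaced by the deterministic \<open>1 / g\<close>, Cauchy-Schwarz
  bounds the signal \<open>S'\<close> from below. Markov's inequality is applied to
  \<open>W\<close>, \<open>Y\<close> and \<open>Z\<close> at \<open>50\<close> times the bounds on
  their means, which accounts for \<open>3/50\<close>; the bound on \<open>W\<close> transfers the
  lower bound from \<open>S'\<close> to the random \<open>S\<close>.\<close>

lemma prob_good_flat:
  fixes h :: "nat pmf"
  assumes h: "set_pmf h \<subseteq> {..<n}" and m: "1 \<le> m" "m \<le> n" and "0 < \<epsilon>"
    and d: "2 * \<epsilon> \<le> (\<Sum>i<n. \<bar>d i\<bar>)"
  shows "measure_pmf.prob (replicate_pmf m h) {u. \<not> good_flat n m \<epsilon> h d (flat_weight u)} \<le> 3/50"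
proof -
  define g where "g = (\<lambda>i. 1 + real m * pmf h i)"
  define S' where "S' = (\<Sum>i<n. (d i)\<^sup>2 / g i)"
  define W where "W = (\<lambda>u. \<Sum>i<n. (d i)\<^sup>2 / (g i)\<^sup>2 * (1 + real (count_list u i)))"
  define Y where "Y = (\<lambda>u. \<Sum>i<n. pmf h i * (d i)\<^sup>2 * (flat_weight u i)\<^sup>2)"
  define Z where "Z = (\<lambda>u. \<Sum>i<n. (pmf h i)\<^sup>2 * (flat_weight u i)\<^sup>2)"
  have fin: "finite (set_pmf h)" using h finite_subset by blast
  note finr = finite_set_replicate_pmf[OF fin, of m]
  note int = integrable_measure_pmf_finite[OF finr]
  have n0: "0 < n" using m by auto
  have g1: "1 \<le> g i" for i by (simp add: g_def)
  have g0: "0 < g i" for i using g1[of i] by linarith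
  \<comment> \<open>Heavy elements are damped: after division by \<open>g\<close> every element has
    mass at most \<open>1 / m\<close>.\<close>
  have hg: "pmf h i / g i \<le> 1 / real m" for i
    using m g0[of i] by (simp add: divide_simps g_def)
  have "(\<Sum>i<n. \<bar>d i\<bar>) = (\<Sum>i<n. (\<bar>d i\<bar> / sqrt (g i)) * sqrt (g i))"
    using g0 by (intro sum.cong) (auto simp: less_imp_neq[THEN not_sym])
  then have "(\<Sum>i<n. \<bar>d i\<bar>)\<^sup>2 \<le> (\<Sum>i<n. (\<bar>d i\<bar> / sqrt (g i))\<^sup>2) * (\<Sum>i<n. (sqrt (g i))\<^sup>2)"
    by (simp only: Cauchy_Schwarz_ineq_sum)
  also have "(\<Sum>i<n. (\<bar>d i\<bar> / sqrt (g i))\<^sup>2) = S'"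
    unfolding S'_def using g0 by (intro sum.cong) (auto simp: power_divide less_imp_le)
  also have "(\<Sum>i<n. (sqrt (g i))\<^sup>2) = (\<Sum>i<n. g i)"
    using g0 by (intro sum.cong) (auto simp: less_imp_le)
  also have "\<dots> = real n + real m"
    by (simp add: g_def sum.distrib sum_distrib_left[symmetric] sum_pmf_lessThan[OF h])
  finally have cs: "(\<Sum>i<n. \<bar>d i\<bar>)\<^sup>2 \<le> S' * (real n + real m)" .
  have S'0: "0 \<le> S'" unfolding S'_def using g0 by (intro sum_nonneg) (simp add: less_imp_le)
  have "(2 * \<epsilon>)\<^sup>2 \<le> (\<Sum>i<n. \<bar>d i\<bar>)\<^sup>2" using d \<open>0 < \<epsilon>\<close> by (intro power_mono) auto
  also note cs
  \<comment> \<open>Because \<open>m \<le> n\<close>, the total of \<open>g\<close> is at most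
    \<open>2 * n\<close>, so flattening costs only a constant factor of the signal.\<close>
  also have "S' * (real n + real m) \<le> S' * (2 * real n)" using S'0 m by (intro mult_left_mono) auto
  finally have S'n: "2 * \<epsilon>\<^sup>2 / real n \<le> S'" using n0 by (simp add: field_simps)
  have "0 < 2 * \<epsilon>\<^sup>2 / real n" using n0 \<open>0 < \<epsilon>\<close> by simp
  with S'n have S'pos: "0 < S'" by linarith
  have "measure_pmf.expectation (replicate_pmf m h) W =
     (\<Sum>i<n. (d i)\<^sup>2 / (g i)\<^sup>2 * g i)"
    unfolding W_def g_def by (simp add: int expectation_count_list[OF fin])
  also have "\<dots> = S'" unfolding S'_def
    using g0 by (intro sum.cong) (auto simp: power2_eq_square less_imp_neq[THEN not_sym])
  finally have EW: "measure_pmf.expectation (replicate_pmf m h) W \<le> S'" by simp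
  have "measure_pmf.expectation (replicate_pmf m h) Y =
     (\<Sum>i<n. pmf h i * (d i)\<^sup>2 * measure_pmf.expectation (replicate_pmf m h) (\<lambda>u. (flat_weight u i)\<^sup>2))"
    unfolding Y_def by (simp add: int)
  also have "\<dots> \<le> (\<Sum>i<n. 8 / real m * ((d i)\<^sup>2 / g i))"
  proof (intro sum_mono)
    fix i
    have "pmf h i * (d i)\<^sup>2 * measure_pmf.expectation (replicate_pmf m h) (\<lambda>u. (flat_weight u i)\<^sup>2)
       \<le> pmf h i * (d i)\<^sup>2 * (8 / (g i)\<^sup>2)"
      unfolding g_def by (intro mult_left_mono expectation_flat_weight_sq[OF fin]) auto
    also have "\<dots> = (pmf h i / g i) * (8 * ((d i)\<^sup>2 / g i))" by (simp add: power2_eq_square)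
    also have "\<dots> \<le> (1 / real m) * (8 * ((d i)\<^sup>2 / g i))"
      using g0[of i] by (intro mult_right_mono hg) (simp add: less_imp_le)
    finally show "pmf h i * (d i)\<^sup>2 * measure_pmf.expectation (replicate_pmf m h) (\<lambda>u. (flat_weight u i)\<^sup>2)
      \<le> 8 / real m * ((d i)\<^sup>2 / g i)" by simp
  qed
  also have "\<dots> = 8 * S' / real m" unfolding S'_def sum_distrib_left[symmetric] by simp
  finally have EY: "measure_pmf.expectation (replicate_pmf m h) Y \<le> 8 * S' / real m" .
  have "measure_pmf.expectation (replicate_pmf m h) Z =
     (\<Sum>i<n. (pmf h i)\<^sup>2 * measure_pmf.expectation (replicate_pmf m h) (\<lambda>u. (flat_weight u i)\<^sup>2))"
    unfolding Z_def by (simp add: int)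
  also have "\<dots> \<le> (\<Sum>i<n. 8 / real m * pmf h i)"
  proof (intro sum_mono)
    fix i
    have "(pmf h i)\<^sup>2 * measure_pmf.expectation (replicate_pmf m h) (\<lambda>u. (flat_weight u i)\<^sup>2)
       \<le> (pmf h i)\<^sup>2 * (8 / (g i)\<^sup>2)"
      unfolding g_def by (intro mult_left_mono expectation_flat_weight_sq[OF fin]) auto
    also have "\<dots> = (pmf h i / g i) * (8 * (pmf h i / g i))" by (simp add: power2_eq_square)
    also have "\<dots> \<le> (1 / real m) * (8 * (pmf h i / 1))"
      using g0[of i] g1[of i] by (intro mult_mono hg divide_left_mono) (simp_all add: less_imp_le)
    finally show "(pmf h i)\<^sup>2 * measure_pmf.expectation (replicate_pmf m h) (\<lambda>u. (flat_weight u i)\<^sup>2)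
      \<le> 8 / real m * pmf h i" by simp
  qed
  also have "\<dots> = 8 / real m" by (simp only: sum_distrib_left[symmetric] sum_pmf_lessThan[OF h] mult_1_right)
  finally have EZ: "measure_pmf.expectation (replicate_pmf m h) Z \<le> 8 / real m" .
  have m0: "0 < real m" using m by simp
  have "measure_pmf.prob (replicate_pmf m h) {u. 50 * S' \<le> W u} \<le> S' / (50 * S')"
    using EW S'pos by (intro markov_finite_pmf[OF finr]) (auto simp: W_def intro!: sum_nonneg)
  then have PW: "measure_pmf.prob (replicate_pmf m h) {u. 50 * S' \<le> W u} \<le> 1/50"
    using S'pos by simp
  have "measure_pmf.prob (replicate_pmf m h) {u. 400 * S' / real m \<le> Y u} \<le> (8 * S' / real m) / (400 * S' / real m)"
    using EY S'pos m0 by (intro markov_finite_pmf[OF finr]) (auto simp: Y_def intro!: sum_nonneg)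
  then have PY: "measure_pmf.prob (replicate_pmf m h) {u. 400 * S' / real m \<le> Y u} \<le> 1/50"
    using S'pos m0 by simp
  have "measure_pmf.prob (replicate_pmf m h) {u. 400 / real m \<le> Z u} \<le> (8 / real m) / (400 / real m)"
    using EZ m0 by (intro markov_finite_pmf[OF finr]) (auto simp: Z_def intro!: sum_nonneg)
  then have PZ: "measure_pmf.prob (replicate_pmf m h) {u. 400 / real m \<le> Z u} \<le> 1/50"
    using m0 by simp
  have good: "good_flat n m \<epsilon> h d (flat_weight u)"
    if u: "W u < 50 * S'" "Y u < 400 * S' / real m" "Z u < 400 / real m" for u
  proof -
    define S where "S = (\<Sum>i<n. flat_weight u i * (d i)\<^sup>2)"
    \<comment> \<open>\<open>S'\<^sup>2 \<le> S W\<close> by Cauchy--Schwarz, so the upper bound on \<open>W\<close>, whose mean is \<open>S'\<close>, bounds \<open>S\<close> from below.\<close>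
    have "S' = (\<Sum>i<n. (\<bar>d i\<bar> * sqrt (flat_weight u i)) * (\<bar>d i\<bar> / g i * sqrt (1 + real (count_list u i))))"
      unfolding S'_def
    proof (intro sum.cong refl)
      fix i
      have "sqrt (flat_weight u i) * sqrt (1 + real (count_list u i)) = 1"
        by (simp add: flat_weight_def real_sqrt_mult[symmetric])
      then show "(d i)\<^sup>2 / g i = (\<bar>d i\<bar> * sqrt (flat_weight u i)) * (\<bar>d i\<bar> / g i * sqrt (1 + real (count_list u i)))"
        by (simp add: algebra_simps power2_eq_square)
    qed
    then have "S'\<^sup>2 \<le> (\<Sum>i<n. (\<bar>d i\<bar> * sqrt (flat_weight u i))\<^sup>2) * (\<Sum>i<n. (\<bar>d i\<bar> / g i * sqrt (1 + real (count_list u i)))\<^sup>2)"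
      by (simp only: Cauchy_Schwarz_ineq_sum)
    also have "(\<Sum>i<n. (\<bar>d i\<bar> * sqrt (flat_weight u i))\<^sup>2) = S"
      unfolding S_def by (intro sum.cong) (auto simp: power_mult_distrib flat_weight_range less_imp_le)
    also have "(\<Sum>i<n. (\<bar>d i\<bar> / g i * sqrt (1 + real (count_list u i)))\<^sup>2) = W u"
      unfolding W_def by (intro sum.cong) (auto simp: power_mult_distrib power_divide)
    finally have "S' * S' \<le> S * W u" by (simp add: power2_eq_square)
    also have "\<dots> \<le> S * (50 * S')"
      using u(1) unfolding S_def by (intro mult_left_mono sum_nonneg) (auto simp: flat_weight_range less_imp_le)
    finally have SS: "S' \<le> 50 * S" using S'pos by simp
    \<comment> \<open>The lower bound \<open>2 * \<epsilon>\<^sup>2 / n\<close> on \<open>S'\<close>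
      loses the Markov factor \<open>50\<close>; the same loss gives \<open>20000 = 400 * 50\<close>
      below.\<close>
    have "\<epsilon>\<^sup>2 / (25 * real n) = (2 * \<epsilon>\<^sup>2 / real n) / 50" by simp
    then have "\<epsilon>\<^sup>2 / (25 * real n) \<le> S" using S'n SS by linarith
    moreover have "Y u \<le> 20000 * S / real m"
    proof -
      have "Y u \<le> 400 * S' / real m" using u by simp
      also have "\<dots> \<le> 400 * (50 * S) / real m" using SS by (intro divide_right_mono) auto
      finally show ?thesis by simp
    qed
    ultimately show ?thesis using u(3)
      by (simp add: good_flat_def Let_def S_def Y_def Z_def mult_ac)
  qed
  have "measure_pmf.prob (replicate_pmf m h) {u. \<not> good_flat n m \<epsilon> h d (flat_weight u)} \<le>
     measure_pmf.prob (replicate_pmf m h) (({u. 50 * S' \<le> W u} \<union> {u. 400 * S' / real m \<le> Y u}) \<union> {u. 400 / real m \<le> Z u})"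
    using good by (intro prob_mono) (auto simp: not_less[symmetric])
  also have "\<dots> \<le> (1/50 + 1/50) + 1/50"
    by (intro prob_Un_le PW PY PZ)
  finally show ?thesis by simp
qed

subsection \<open>The weighted closeness statistic\<close>

definition sep :: "nat \<Rightarrow> nat pmf \<Rightarrow> nat pmf \<Rightarrow> (nat \<Rightarrow> real) \<Rightarrow> real" where
  "sep n p q c = (\<Sum>i<n. c i * (pmf p i - pmf q i)\<^sup>2)"

text \<open>The second moments of \<open>c * (p - q)\<close> under \<open>p\<close> and under
  \<open>q\<close>, added up; up to a constant this is the per-sample noise of \<open>wt_gap\<close>
  around \<open>sep\<close>.\<close>

definition lin_var :: "nat \<Rightarrow> nat pmf \<Rightarrow> nat pmf \<Rightarrow> (nat \<Rightarrow> real) \<Rightarrow> real" where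
  "lin_var n p q c = (\<Sum>i<n. (pmf p i + pmf q i) * ((c i)\<^sup>2 * (pmf p i - pmf q i)\<^sup>2))"

text \<open>Measures the sampling error of the learned weights: divided by the sample size and up to
  a constant, it is their contribution to the mean of \<open>wt_energy\<close>.\<close>

definition quad_var :: "nat \<Rightarrow> nat pmf \<Rightarrow> nat pmf \<Rightarrow> (nat \<Rightarrow> real) \<Rightarrow> real" where
  "quad_var n p q c = (\<Sum>i<n. (pmf p i + pmf q i)\<^sup>2 * (c i)\<^sup>2)"

definition wt_gap :: "nat \<Rightarrow> nat pmf \<Rightarrow> nat pmf \<Rightarrow> (nat \<Rightarrow> real) \<Rightarrow> real" where
  "wt_gap n p q w = (\<Sum>i<n. w i * (pmf p i - pmf q i))"

text \<open>The second moments of \<open>w\<close> under \<open>p\<close> and under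
  \<open>q\<close>, added up; they bound the variance of averages of \<open>w\<close> over fresh
  samples.\<close>

definition wt_energy :: "nat \<Rightarrow> nat pmf \<Rightarrow> nat pmf \<Rightarrow> (nat \<Rightarrow> real) \<Rightarrow> real" where
  "wt_energy n p q w = (\<Sum>i<n. (pmf p i + pmf q i) * (w i)\<^sup>2)"

lemma finite_pair_replicate:
  fixes p q :: "nat pmf"
  assumes "set_pmf p \<subseteq> {..<n}" "set_pmf q \<subseteq> {..<n}"
  shows "finite (set_pmf (pair_pmf (replicate_pmf s p) (replicate_pmf s q)))"
  using assms finite_subset[OF assms(1)] finite_subset[OF assms(2)]
  by (auto intro!: finite_cartesian_product finite_set_replicate_pmf)

text \<open>For fixed \<open>c\<close> the gap of the learned weights is the difference of two
  averages of the fixed function \<open>c * (p - q)\<close>, whose means differ by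
  \<open>sep\<close>. The squared deviation is split over the two averages and Markov's inequality
  finishes.\<close>

lemma prob_wt_gap:
  fixes p q :: "nat pmf"
  assumes p: "set_pmf p \<subseteq> {..<n}" and q: "set_pmf q \<subseteq> {..<n}" and s: "0 < s" and t: "0 < t"
  shows "measure_pmf.prob (pair_pmf (replicate_pmf s p) (replicate_pmf s q))
    {z. t \<le> \<bar>wt_gap n p q (wt c (fst z) (snd z)) - sep n p q c\<bar>} \<le> 2 * lin_var n p q c / (real s * t\<^sup>2)"
proof -
  define f where "f = (\<lambda>i. c i * (pmf p i - pmf q i))"
  define a where "a = (\<lambda>X. avg f X - measure_pmf.expectation p f)"
  define b where "b = (\<lambda>X. avg f X - measure_pmf.expectation q f)"
  let ?M = "pair_pmf (replicate_pmf s p) (replicate_pmf s q)"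
  have finp: "finite (set_pmf p)" and finq: "finite (set_pmf q)"
    using p q finite_subset by blast+
  note int = integrable_measure_pmf_finite[OF finite_pair_replicate[OF p q]]
  have lv: "lin_var n p q c = measure_pmf.expectation p (\<lambda>x. (f x)\<^sup>2) + measure_pmf.expectation q (\<lambda>x. (f x)\<^sup>2)"
    unfolding expectation_lessThan[OF p] expectation_lessThan[OF q] lin_var_def f_def
    by (simp add: sum.distrib[symmetric] power_mult_distrib distrib_right)
  have sp: "sep n p q c = measure_pmf.expectation p f - measure_pmf.expectation q f"
    unfolding expectation_lessThan[OF p] expectation_lessThan[OF q] sep_def f_def
    by (simp add: sum_subtractf[symmetric] power2_eq_square algebra_simps)
  have dec: "wt_gap n p q (wt c (fst z) (snd z)) - sep n p q c = a (fst z) - b (snd z)" if "z \<in> set_pmf ?M" for z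
  proof -
    have "set (fst z) \<subseteq> {..<n}" "set (snd z) \<subseteq> {..<n}"
      using that p q by (auto simp: set_replicate_pmf lists_eq_set)
    then have "wt_gap n p q (wt c (fst z) (snd z)) = avg f (fst z) - avg f (snd z)"
      by (simp add: avg_freq wt_gap_def wt_def f_def sum_subtractf[symmetric] algebra_simps)
    then show ?thesis by (simp add: sp a_def b_def)
  qed
  have "measure_pmf.expectation ?M (\<lambda>z. (a (fst z) - b (snd z))\<^sup>2) \<le>
      measure_pmf.expectation ?M (\<lambda>z. 2 * (a (fst z))\<^sup>2 + 2 * (b (snd z))\<^sup>2)"
  proof (intro integral_mono int)
    fix z
    have "0 \<le> (a (fst z) + b (snd z))\<^sup>2" by simp
    then show "(a (fst z) - b (snd z))\<^sup>2 \<le> 2 * (a (fst z))\<^sup>2 + 2 * (b (snd z))\<^sup>2"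
      by (simp add: power2_eq_square algebra_simps)
  qed
  also have "\<dots> = 2 * measure_pmf.expectation (replicate_pmf s p) (\<lambda>X. (a X)\<^sup>2) +
      2 * measure_pmf.expectation (replicate_pmf s q) (\<lambda>X. (b X)\<^sup>2)"
    using expectation_pair_fst[of "replicate_pmf s p" "replicate_pmf s q" "\<lambda>X. (a X)\<^sup>2"]
      expectation_pair_snd[of "replicate_pmf s p" "replicate_pmf s q" "\<lambda>X. (b X)\<^sup>2"]
    by (simp add: int)
  also have "\<dots> \<le> 2 * (measure_pmf.expectation p (\<lambda>x. (f x)\<^sup>2) / real s) + 2 * (measure_pmf.expectation q (\<lambda>x. (f x)\<^sup>2) / real s)"
    unfolding a_def b_def
    by (intro add_mono mult_left_mono avg_variance finp finq s) auto
  also have "\<dots> = 2 * lin_var n p q c / real s" by (simp add: lv add_divide_distrib)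
  finally have E: "measure_pmf.expectation ?M (\<lambda>z. (a (fst z) - b (snd z))\<^sup>2) \<le> 2 * lin_var n p q c / real s" .
  have eq: "(t \<le> \<bar>y\<bar>) = (t\<^sup>2 \<le> y\<^sup>2)" for y :: real
    using t by (metis abs_le_square_iff abs_of_pos)
  have "measure_pmf.prob ?M {z. t \<le> \<bar>wt_gap n p q (wt c (fst z) (snd z)) - sep n p q c\<bar>} \<le>
     measure_pmf.prob ?M {z. t\<^sup>2 \<le> (a (fst z) - b (snd z))\<^sup>2}"
    using dec eq by (intro prob_mono) (metis (mono_tags, lifting) IntE mem_Collect_eq subsetI)
  also have "\<dots> \<le> (2 * lin_var n p q c / real s) / t\<^sup>2"
    using t by (intro markov_finite_pmf[OF finite_pair_replicate[OF p q]] E) auto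
  finally show ?thesis by simp
qed

lemma sq_sum3_le: "(x - y + z :: real)\<^sup>2 \<le> 3 * x\<^sup>2 + 3 * y\<^sup>2 + 3 * z\<^sup>2"
proof -
  have "0 \<le> (x + y)\<^sup>2 + (y + z)\<^sup>2 + (x - z)\<^sup>2" by simp
  then show ?thesis by (simp add: power2_eq_square algebra_simps)
qed

text \<open>The difference of the empirical frequencies is split into two sampling errors and the
  true difference: the latter yields \<open>lin_var\<close>, the former yield
  \<open>quad_var / s\<close>.\<close>

lemma prob_wt_energy:
  fixes p q :: "nat pmf"
  assumes p: "set_pmf p \<subseteq> {..<n}" and q: "set_pmf q \<subseteq> {..<n}" and s: "0 < s" and b: "0 < b"
  shows "measure_pmf.prob (pair_pmf (replicate_pmf s p) (replicate_pmf s q))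
    {z. b \<le> wt_energy n p q (wt c (fst z) (snd z))} \<le> 3 * (lin_var n p q c + quad_var n p q c / real s) / b"
proof (rule markov_finite_pmf[OF finite_pair_replicate[OF p q]])
  let ?M = "pair_pmf (replicate_pmf s p) (replicate_pmf s q)"
  note int = integrable_measure_pmf_finite[OF finite_pair_replicate[OF p q]]
  let ?d = "\<lambda>i. pmf p i - pmf q i"
  let ?a = "\<lambda>i. pmf p i + pmf q i"
  have ef: "measure_pmf.expectation ?M (\<lambda>z. (freq (fst z) i - freq (snd z) i)\<^sup>2) \<le> 3 * (?d i)\<^sup>2 + 3 * ?a i / real s" for i
  proof -
    have "measure_pmf.expectation ?M (\<lambda>z. (freq (fst z) i - freq (snd z) i)\<^sup>2) \<le>
      measure_pmf.expectation ?M (\<lambda>z. 3 * (freq (fst z) i - pmf p i)\<^sup>2 + 3 * (freq (snd z) i - pmf q i)\<^sup>2 + 3 * (?d i)\<^sup>2)"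
    proof (intro integral_mono int)
      fix z
      show "(freq (fst z) i - freq (snd z) i)\<^sup>2 \<le> 3 * (freq (fst z) i - pmf p i)\<^sup>2 + 3 * (freq (snd z) i - pmf q i)\<^sup>2 + 3 * (?d i)\<^sup>2"
        using sq_sum3_le[of "freq (fst z) i - pmf p i" "freq (snd z) i - pmf q i" "?d i"] by simp
    qed
    also have "\<dots> = 3 * measure_pmf.expectation (replicate_pmf s p) (\<lambda>X. (freq X i - pmf p i)\<^sup>2)
       + 3 * measure_pmf.expectation (replicate_pmf s q) (\<lambda>X. (freq X i - pmf q i)\<^sup>2) + 3 * (?d i)\<^sup>2"
      using expectation_pair_fst[of "replicate_pmf s p" "replicate_pmf s q" "\<lambda>X. (freq X i - pmf p i)\<^sup>2"]
        expectation_pair_snd[of "replicate_pmf s p" "replicate_pmf s q" "\<lambda>X. (freq X i - pmf q i)\<^sup>2"]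
      by (simp add: int)
    also have "\<dots> \<le> 3 * (pmf p i / real s) + 3 * (pmf q i / real s) + 3 * (?d i)\<^sup>2"
      by (intro add_mono mult_left_mono freq_variance[OF p s] freq_variance[OF q s]) auto
    finally show ?thesis by (simp add: add_divide_distrib)
  qed
  have "measure_pmf.expectation ?M (\<lambda>z. wt_energy n p q (wt c (fst z) (snd z))) =
    (\<Sum>i<n. ?a i * (c i)\<^sup>2 * measure_pmf.expectation ?M (\<lambda>z. (freq (fst z) i - freq (snd z) i)\<^sup>2))"
    unfolding wt_energy_def wt_def power_mult_distrib mult.assoc by (simp add: int)
  also have "\<dots> \<le> (\<Sum>i<n. ?a i * (c i)\<^sup>2 * (3 * (?d i)\<^sup>2 + 3 * ?a i / real s))"
    by (intro sum_mono mult_left_mono ef) simp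
  also have "\<dots> = 3 * (lin_var n p q c + quad_var n p q c / real s)"
  proof -
    have "a * g * (3 * d + 3 * a / r) = 3 * (a * (g * d) + a\<^sup>2 * g / r)" for a g d r :: real
      by (simp add: algebra_simps power2_eq_square)
    then show ?thesis
      unfolding lin_var_def quad_var_def sum_divide_distrib sum.distrib[symmetric] sum_distrib_left
      by (simp only:)
  qed
  finally show "measure_pmf.expectation ?M (\<lambda>z. wt_energy n p q (wt c (fst z) (snd z))) \<le>
    3 * (lin_var n p q c + quad_var n p q c / real s)" .
qed (use b in \<open>auto simp: wt_energy_def intro!: sum_nonneg\<close>)

text \<open>Two orders of the arguments, so that both distributions of a pair are bounded by the
  same \<open>wt_energy n p q w\<close>.\<close>

lemma expectation_sq_le_energy:
  fixes p q :: "nat pmf"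
  assumes "set_pmf p \<subseteq> {..<n}"
  shows "measure_pmf.expectation p (\<lambda>x. (w x)\<^sup>2) \<le> wt_energy n p q w"
    and "measure_pmf.expectation p (\<lambda>x. (w x)\<^sup>2) \<le> wt_energy n q p w"
  unfolding expectation_lessThan[OF assms] wt_energy_def
  by (intro sum_mono mult_right_mono; simp)+

lemma wt_gap_expectation:
  fixes p q :: "nat pmf"
  assumes "set_pmf p \<subseteq> {..<n}" "set_pmf q \<subseteq> {..<n}"
  shows "wt_gap n p q w = measure_pmf.expectation p w - measure_pmf.expectation q w"
  unfolding expectation_lessThan[OF assms(1)] expectation_lessThan[OF assms(2)] wt_gap_def
  by (simp add: sum_subtractf[symmetric] algebra_simps)

lemma prob_avg_pair:
  fixes p q :: "nat pmf"
  assumes p: "set_pmf p \<subseteq> {..<n}" and q: "set_pmf q \<subseteq> {..<n}" and s: "0 < s" and t: "0 < t"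
  shows "measure_pmf.prob (pair_pmf (replicate_pmf s p) (replicate_pmf s q))
    {z. t \<le> \<bar>avg w (fst z) - measure_pmf.expectation p w\<bar> \<or>
        t \<le> \<bar>avg w (snd z) - measure_pmf.expectation q w\<bar>} \<le> wt_energy n p q w / (real s * t\<^sup>2)"
proof -
  have finp: "finite (set_pmf p)" and finq: "finite (set_pmf q)"
    using p q finite_subset by blast+
  have "measure_pmf.prob (pair_pmf (replicate_pmf s p) (replicate_pmf s q))
    {z. fst z \<in> {X. t \<le> \<bar>avg w X - measure_pmf.expectation p w\<bar>} \<or>
        snd z \<in> {X. t \<le> \<bar>avg w X - measure_pmf.expectation q w\<bar>}} \<le>
     measure_pmf.expectation p (\<lambda>x. (w x)\<^sup>2) / (real s * t\<^sup>2) + measure_pmf.expectation q (\<lambda>x. (w x)\<^sup>2) / (real s * t\<^sup>2)"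
    by (intro prob_pair_le avg_chebyshev finp finq s t)
  also have "\<dots> = wt_energy n p q w / (real s * t\<^sup>2)"
    unfolding expectation_lessThan[OF p] expectation_lessThan[OF q] wt_energy_def
    by (simp add: add_divide_distrib[symmetric] sum.distrib[symmetric] algebra_simps)
  finally show ?thesis by simp
qed

text \<open>The first pair of batches learns \<open>w\<close>, an independent second pair evaluates
  it. Given the first, \<open>w\<close> is a fixed function, so Chebyshev's inequality applies
  conditionally.\<close>

definition closeness_stat :: "nat \<Rightarrow> (nat \<Rightarrow> real) \<Rightarrow> nat pmf \<Rightarrow> nat pmf \<Rightarrow> real pmf" where
  "closeness_stat s c p q =
     bind_pmf (pair_pmf (replicate_pmf s p) (replicate_pmf s q)) (\<lambda>z.
     map_pmf (\<lambda>z'. avg (wt c (fst z) (snd z)) (fst z') - avg (wt c (fst z) (snd z)) (snd z'))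
       (pair_pmf (replicate_pmf s p) (replicate_pmf s q)))"

text \<open>The deviation \<open>t\<close> is shared out: \<open>t/2\<close> for the gap of the
  learned weights and \<open>t/4\<close> for each of the two fresh averages.\<close>

lemma closeness_stat_concentration:
  fixes p q :: "nat pmf"
  assumes p: "set_pmf p \<subseteq> {..<n}" and q: "set_pmf q \<subseteq> {..<n}" and s: "0 < s" and t: "0 < t"
    and lin: "lin_var n p q c \<le> real s * t\<^sup>2 / 10^6"
    and quad: "quad_var n p q c \<le> (real s)\<^sup>2 * t\<^sup>2 / 10^6"
  shows "measure_pmf.prob (closeness_stat s c p q) {T. t \<le> \<bar>T - sep n p q c\<bar>} \<le> 1/16"
proof -
  \<comment> \<open>Chosen so that the final Chebyshev bound \<open>b / (s * (t/4)\<^sup>2)\<close>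
    equals \<open>1/64\<close>.\<close>
  define b where "b = real s * t\<^sup>2 / 1024"
  have st: "0 < real s * t\<^sup>2" using s t by simp
  then have b0: "0 < b" by (simp add: b_def)
  let ?M = "pair_pmf (replicate_pmf s p) (replicate_pmf s q)"
  let ?w = "\<lambda>z. wt c (fst z) (snd z)"
  have "measure_pmf.prob ?M {z. t/2 \<le> \<bar>wt_gap n p q (?w z) - sep n p q c\<bar>} \<le> 2 * lin_var n p q c / (real s * (t/2)\<^sup>2)"
    by (rule prob_wt_gap[OF p q s]) (use t in simp)
  also have "\<dots> = 8 * lin_var n p q c / (real s * t\<^sup>2)" by (simp add: power_divide)
  also have "\<dots> \<le> 8 / 10^6"
    using lin st by (simp only: pos_divide_le_eq) simp
  finally have 1: "measure_pmf.prob ?M {z. t/2 \<le> \<bar>wt_gap n p q (?w z) - sep n p q c\<bar>} \<le> 8 / 10^6" .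
  have "measure_pmf.prob ?M {z. b \<le> wt_energy n p q (?w z)} \<le> 3 * (lin_var n p q c + quad_var n p q c / real s) / b"
    by (rule prob_wt_energy[OF p q s b0])
  also have "\<dots> \<le> 1/64"
  proof -
    have "quad_var n p q c / real s \<le> ((real s)\<^sup>2 * t\<^sup>2 / 10^6) / real s"
      using quad s by (intro divide_right_mono) auto
    also have "\<dots> = real s * t\<^sup>2 / 10^6" using s by (simp add: power2_eq_square)
    finally have "3 * (lin_var n p q c + quad_var n p q c / real s) \<le> 6 * (real s * t\<^sup>2 / 10^6)"
      using lin by simp
    also have "\<dots> \<le> 1/64 * b" using st by (simp add: b_def)
    finally show ?thesis using b0 by (simp add: pos_divide_le_eq)
  qed
  finally have 2: "measure_pmf.prob ?M {z. b \<le> wt_energy n p q (?w z)} \<le> 1/64" .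
  have "measure_pmf.prob (closeness_stat s c p q) {T. t \<le> \<bar>T - sep n p q c\<bar>} \<le> (8/10^6 + 1/64) + 1/64"
    unfolding closeness_stat_def
  proof (rule prob_bind_le[OF prob_Un_le[OF 1 2]])
    fix z
    assume "z \<notin> {z. t / 2 \<le> \<bar>wt_gap n p q (?w z) - sep n p q c\<bar>} \<union> {z. b \<le> wt_energy n p q (?w z)}"
    then have z: "\<bar>wt_gap n p q (?w z) - sep n p q c\<bar> < t / 2" "wt_energy n p q (?w z) < b" by auto
    have "measure_pmf.prob (map_pmf (\<lambda>z'. avg (?w z) (fst z') - avg (?w z) (snd z')) ?M) {T. t \<le> \<bar>T - sep n p q c\<bar>}
      \<le> measure_pmf.prob ?M {z'. t/4 \<le> \<bar>avg (?w z) (fst z') - measure_pmf.expectation p (?w z)\<bar> \<or>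
            t/4 \<le> \<bar>avg (?w z) (snd z') - measure_pmf.expectation q (?w z)\<bar>}"
    proof -
      have "t / 4 \<le> \<bar>x - a\<bar> \<or> t / 4 \<le> \<bar>y - b\<bar>"
        if "\<bar>(a - b) - S\<bar> < t / 2" "t \<le> \<bar>x - y - S\<bar>" for a b x y S :: real
        using that by arith
      from this[OF z(1)[unfolded wt_gap_expectation[OF p q]]] show ?thesis
        unfolding measure_map_pmf by (intro prob_mono) blast
    qed
    also have "\<dots> \<le> wt_energy n p q (?w z) / (real s * (t/4)\<^sup>2)"
      by (rule prob_avg_pair[OF p q s]) (use t in simp)
    also have "\<dots> \<le> b / (real s * (t/4)\<^sup>2)" using z(2) by (intro divide_right_mono) auto
    also have "\<dots> = 1/64" using s t by (simp add: b_def power_divide)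
    finally show "measure_pmf.prob (map_pmf (\<lambda>z'. avg (?w z) (fst z') - avg (?w z) (snd z')) ?M) {T. t \<le> \<bar>T - sep n p q c\<bar>} \<le> 1/64" .
  qed simp
  then show ?thesis by simp
qed

subsection \<open>Testing and separating\<close>

text \<open>Weights drawn from the equal mixture damp the heavy elements of both distributions at
  once; the noise sums of \<open>good_flat\<close> then agree with \<open>lin_var\<close> and
  \<open>quad_var\<close> up to the factors \<open>2\<close> and \<open>4\<close>.\<close>

definition mix :: "nat pmf \<Rightarrow> nat pmf \<Rightarrow> nat pmf" where
  "mix p q = bind_pmf (bernoulli_pmf (1/2)) (\<lambda>b. if b then p else q)"

lemma pmf_mix: "pmf (mix p q) i = (pmf p i + pmf q i) / 2"
  by (simp add: mix_def pmf_bind)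

lemma set_pmf_mix: "set_pmf p \<subseteq> A \<Longrightarrow> set_pmf q \<subseteq> A \<Longrightarrow> set_pmf (mix p q) \<subseteq> A"
  by (auto simp: mix_def split: if_splits)

definition vote :: "nat \<Rightarrow> bool pmf \<Rightarrow> bool pmf" where
  "vote L \<mu> = map_pmf (\<lambda>bs. 2 * count_list bs True > length bs) (replicate_pmf L \<mu>)"

definition closeness_test :: "nat \<Rightarrow> real \<Rightarrow> (nat \<Rightarrow> real) \<Rightarrow> nat pmf \<Rightarrow> nat pmf \<Rightarrow> bool pmf" where
  "closeness_test s \<theta> c p q = map_pmf (\<lambda>T. T > \<theta>) (closeness_stat s c p q)"

text \<open>For equal distributions \<open>sep\<close> and \<open>lin_var\<close> vanish; what
  remains is the quadratic noise, at most \<open>1600 / m\<close>, which \<open>size\<close> keeps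
  below the threshold.\<close>

lemma closeness_test_equal:
  fixes p :: "nat pmf"
  assumes p: "set_pmf p \<subseteq> {..<n}" and "0 < \<epsilon>" "0 < m" "0 < n"
    and good: "good_flat n m \<epsilon> p d c"
    and size: "10^13 * real n \<le> real s * sqrt (real m) * \<epsilon>\<^sup>2"
  shows "measure_pmf.prob (closeness_test s (\<epsilon>\<^sup>2 / (50 * real n)) c p p) {b. b \<noteq> False} \<le> 1/16"
proof -
  \<comment> \<open>Half of the separation that \<open>good_flat\<close> guarantees.\<close>
  define \<theta> where "\<theta> = \<epsilon>\<^sup>2 / (50 * real n)"
  have \<theta>: "0 < \<theta>" using assms by (simp add: \<theta>_def)
  have s: "0 < s" using size \<open>0 < n\<close> by (cases "s = 0") auto
  have sep0: "sep n p p c = 0" by (simp add: sep_def)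
  have "2 * 10^11 \<le> real s * sqrt (real m) * \<theta>"
    using size \<open>0 < n\<close> by (simp add: \<theta>_def field_simps)
  then have "(2 * 10^11)\<^sup>2 \<le> (real s * sqrt (real m) * \<theta>)\<^sup>2" by (intro power_mono) auto
  also have "\<dots> = (real s)\<^sup>2 * \<theta>\<^sup>2 * real m" by (simp add: power_mult_distrib)
  finally have big: "(2 * 10^11)\<^sup>2 \<le> (real s)\<^sup>2 * \<theta>\<^sup>2 * real m" .
  have "quad_var n p p c = 4 * (\<Sum>i<n. (pmf p i)\<^sup>2 * (c i)\<^sup>2)"
    by (simp add: quad_var_def sum_distrib_left power2_eq_square algebra_simps)
  also have "\<dots> \<le> 4 * (400 / real m)"
    using good by (simp add: good_flat_def Let_def)
  also have "\<dots> \<le> (real s)\<^sup>2 * \<theta>\<^sup>2 / 10^6"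
    using big \<open>0 < m\<close> by (simp add: divide_simps)
  finally have quad: "quad_var n p p c \<le> (real s)\<^sup>2 * \<theta>\<^sup>2 / 10^6" .
  have "measure_pmf.prob (closeness_stat s c p p) {T. \<theta> \<le> \<bar>T - sep n p p c\<bar>} \<le> 1/16"
    by (rule closeness_stat_concentration[OF p p s \<theta> _ quad]) (simp add: lin_var_def)
  moreover have "measure_pmf.prob (closeness_test s \<theta> c p p) {b. b \<noteq> False} \<le>
      measure_pmf.prob (closeness_stat s c p p) {T. \<theta> \<le> \<bar>T - sep n p p c\<bar>}"
    unfolding closeness_test_def measure_map_pmf by (intro prob_mono) (auto simp: sep0)
  ultimately show ?thesis by (simp add: \<theta>_def)
qed

text \<open>When only samples of \<open>p\<close> enter the weights, \<open>q\<close> may be unflattened; its excess over \<open>p\<close> is at most \<open>|p - q|\<close>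
  and is therefore charged to the separation itself.\<close>

lemma lin_var_one_sided:
  fixes p q :: "nat pmf"
  assumes c: "\<And>i. 0 < c i" "\<And>i. c i \<le> 1"
  shows "lin_var n p q c \<le> 2 * (\<Sum>i<n. pmf p i * ((c i)\<^sup>2 * (pmf p i - pmf q i)\<^sup>2)) + sep n p q c * sqrt (sep n p q c)"
proof -
  let ?S = "sep n p q c"
  have le: "c i * (pmf p i - pmf q i)\<^sup>2 \<le> ?S" if "i < n" for i
    unfolding sep_def using c that by (intro member_le_sum) (auto simp: less_imp_le)
  have "lin_var n p q c \<le> (\<Sum>i<n. 2 * (pmf p i * ((c i)\<^sup>2 * (pmf p i - pmf q i)\<^sup>2)) + c i * (pmf p i - pmf q i)\<^sup>2 * sqrt ?S)"
    unfolding lin_var_def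
  proof (intro sum_mono)
    fix i assume "i \<in> {..<n}"
    then have i: "i < n" by simp
    let ?d = "pmf p i - pmf q i"
    \<comment> \<open>The square of the left side is at most a single term of
      \<open>?S\<close>.\<close>
    have "c i * \<bar>?d\<bar> = sqrt ((c i * \<bar>?d\<bar>)\<^sup>2)" using c(1)[of i] by simp
    also have "(c i * \<bar>?d\<bar>)\<^sup>2 = c i * (c i * ?d\<^sup>2)" by (simp add: power2_eq_square)
    also have "\<dots> \<le> 1 * (c i * ?d\<^sup>2)" using c[of i] by (intro mult_right_mono) (auto simp: less_imp_le)
    also have "\<dots> \<le> ?S" using le[OF i] by simp
    finally have cd: "c i * \<bar>?d\<bar> \<le> sqrt ?S" by simp
    have "(pmf p i + pmf q i) * ((c i)\<^sup>2 * ?d\<^sup>2) \<le> (2 * pmf p i + \<bar>?d\<bar>) * ((c i)\<^sup>2 * ?d\<^sup>2)"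
      by (intro mult_right_mono) auto
    also have "\<dots> = 2 * (pmf p i * ((c i)\<^sup>2 * ?d\<^sup>2)) + (c i * ?d\<^sup>2) * (c i * \<bar>?d\<bar>)"
      by (simp add: algebra_simps power2_eq_square)
    also have "\<dots> \<le> 2 * (pmf p i * ((c i)\<^sup>2 * ?d\<^sup>2)) + (c i * ?d\<^sup>2) * sqrt ?S"
      using c(1)[of i] by (intro add_left_mono mult_left_mono cd) (auto simp: less_imp_le)
    finally show "(pmf p i + pmf q i) * ((c i)\<^sup>2 * ?d\<^sup>2) \<le> 2 * (pmf p i * ((c i)\<^sup>2 * ?d\<^sup>2)) + c i * ?d\<^sup>2 * sqrt ?S" .
  qed
  also have "\<dots> = 2 * (\<Sum>i<n. pmf p i * ((c i)\<^sup>2 * (pmf p i - pmf q i)\<^sup>2)) + ?S * sqrt ?S"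
    by (simp add: sum.distrib sum_distrib_left[symmetric] sum_distrib_right[symmetric] sep_def)
  finally show ?thesis .
qed

text \<open>Writing \<open>p + q = 2 * p - d\<close>, the square is at most
  \<open>8 * p\<^sup>2 + 2 * d\<^sup>2\<close>, and \<open>c\<^sup>2 \<le> c\<close> charges the
  second term to the separation.\<close>

lemma quad_var_one_sided:
  fixes p q :: "nat pmf"
  assumes c: "\<And>i. 0 < c i" "\<And>i. c i \<le> 1"
  shows "quad_var n p q c \<le> 8 * (\<Sum>i<n. (pmf p i)\<^sup>2 * (c i)\<^sup>2) + 2 * sep n p q c"
proof -
  have "quad_var n p q c \<le> (\<Sum>i<n. 8 * ((pmf p i)\<^sup>2 * (c i)\<^sup>2) + 2 * (c i * (pmf p i - pmf q i)\<^sup>2))"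
    unfolding quad_var_def
  proof (intro sum_mono)
    fix i
    let ?d = "pmf p i - pmf q i"
    have "0 \<le> (2 * pmf p i + ?d)\<^sup>2" by simp
    then have "(pmf p i + pmf q i)\<^sup>2 \<le> 8 * (pmf p i)\<^sup>2 + 2 * ?d\<^sup>2"
      by (simp add: power2_eq_square algebra_simps)
    then have "(pmf p i + pmf q i)\<^sup>2 * (c i)\<^sup>2 \<le> (8 * (pmf p i)\<^sup>2 + 2 * ?d\<^sup>2) * (c i)\<^sup>2"
      by (intro mult_right_mono) auto
    also have "\<dots> = 8 * ((pmf p i)\<^sup>2 * (c i)\<^sup>2) + 2 * (c i * (c i * ?d\<^sup>2))"
      by (simp add: algebra_simps power2_eq_square)
    also have "c i * (c i * ?d\<^sup>2) \<le> 1 * (c i * ?d\<^sup>2)"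
      using c[of i] by (intro mult_right_mono) (auto simp: less_imp_le)
    finally show "(pmf p i + pmf q i)\<^sup>2 * (c i)\<^sup>2 \<le> 8 * ((pmf p i)\<^sup>2 * (c i)\<^sup>2) + 2 * (c i * ?d\<^sup>2)" by simp
  qed
  also have "\<dots> = 8 * (\<Sum>i<n. (pmf p i)\<^sup>2 * (c i)\<^sup>2) + 2 * sep n p q c"
    by (simp add: sum.distrib sum_distrib_left[symmetric] sep_def)
  finally show ?thesis .
qed

text \<open>The threshold is at most \<open>S/2\<close>, so an error needs a deviation of
  \<open>S/2\<close>. Linear and quadratic noise each have one part from the flattened
  \<open>p\<close> and one from the excess of \<open>q\<close>; each part gets half of the
  allowance, whence \<open>8 * 10^6\<close>.\<close>

lemma closeness_test_far:
  fixes p q :: "nat pmf"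
  assumes p: "set_pmf p \<subseteq> {..<n}" and q: "set_pmf q \<subseteq> {..<n}" and e: "0 < \<epsilon>" "\<epsilon> \<le> 1" and m: "0 < m" "m \<le> n"
    and c: "\<And>i. 0 < c i" "\<And>i. c i \<le> 1"
    and good: "good_flat n m \<epsilon> p (\<lambda>i. pmf p i - pmf q i) c"
    and size: "10^13 * real n \<le> real s * sqrt (real m) * \<epsilon>\<^sup>2"
  shows "measure_pmf.prob (closeness_test s (\<epsilon>\<^sup>2 / (50 * real n)) c p q) {b. b \<noteq> True} \<le> 1/16"
proof -
  define S where "S = sep n p q c"
  have n0: "0 < n" using m by simp
  have s: "0 < s" using size n0 by (cases "s = 0") auto
  have g: "\<epsilon>\<^sup>2 / (25 * real n) \<le> S"
    "(\<Sum>i<n. pmf p i * ((c i)\<^sup>2 * (pmf p i - pmf q i)\<^sup>2)) \<le> 20000 * S / real m"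
    "(\<Sum>i<n. (pmf p i)\<^sup>2 * (c i)\<^sup>2) \<le> 400 / real m"
    using good by (auto simp: good_flat_def Let_def S_def sep_def)
  have "0 < \<epsilon>\<^sup>2 / (25 * real n)" using e n0 by simp
  with g(1) have S: "0 < S" by linarith
  have "4 * 10^11 \<le> real s * sqrt (real m) * (\<epsilon>\<^sup>2 / (25 * real n))"
    using size n0 by (simp add: field_simps)
  also have "\<dots> \<le> real s * sqrt (real m) * S" using g(1) by (intro mult_left_mono) auto
  finally have y: "4 * 10^11 \<le> real s * sqrt (real m) * S" .
  have "sqrt (real m) \<le> real m" using m by (intro real_le_lsqrt) (auto simp: power2_eq_square)
  then have "real s * sqrt (real m) * S \<le> real s * real m * S"
    using S by (intro mult_right_mono mult_left_mono) auto
  with y have ym: "4 * 10^11 \<le> real s * real m * S" by linarith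
  have "(4 * 10^11)\<^sup>2 \<le> (real s * sqrt (real m) * S)\<^sup>2" using y by (intro power_mono) auto
  also have "\<dots> = (real s)\<^sup>2 * S\<^sup>2 * real m" by (simp add: power_mult_distrib)
  finally have y2: "(4 * 10^11)\<^sup>2 \<le> (real s)\<^sup>2 * S\<^sup>2 * real m" .
  \<comment> \<open>The excess of \<open>q\<close> requires \<open>s * sqrt S\<close> to be large.
    As \<open>m \<le> n\<close> and \<open>\<epsilon> \<le> 1\<close>, \<open>size\<close> gives
    \<open>10^13 * sqrt n \<le> s * \<epsilon>\<close>, while \<open>sqrt S\<close> is at least
    \<open>\<epsilon> / (5 * sqrt n)\<close>.\<close>
  have sS: "2 * 10^12 \<le> real s * sqrt S"
  proof -
    have "real s * sqrt (real m) * \<epsilon>\<^sup>2 \<le> real s * sqrt (real n) * (\<epsilon> * 1)"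
      using m e by (auto intro!: mult_mono mult_left_mono simp: power2_eq_square)
    with size have "10^13 * real n \<le> real s * sqrt (real n) * \<epsilon>" by simp
    also have "10^13 * real n = 10^13 * sqrt (real n) * sqrt (real n)" by simp
    finally have "(10^13 * sqrt (real n)) * sqrt (real n) \<le> (real s * \<epsilon>) * sqrt (real n)" by (simp add: mult_ac)
    then have "10^13 * sqrt (real n) \<le> real s * \<epsilon>" using n0 by (subst (asm) mult_le_cancel_right) auto
    then have "2 * 10^12 \<le> real s * (\<epsilon> / (5 * sqrt (real n)))" using n0 by (simp add: field_simps)
    also have "\<epsilon> / (5 * sqrt (real n)) = sqrt (\<epsilon>\<^sup>2 / (25 * real n))"
      using e by (simp add: real_sqrt_divide real_sqrt_mult)
    also have "real s * \<dots> \<le> real s * sqrt S" using g(1) by (intro mult_left_mono) auto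
    finally show ?thesis .
  qed
  then have "(2 * 10^12)\<^sup>2 \<le> (real s * sqrt S)\<^sup>2" by (intro power_mono) auto
  then have s2S: "(2 * 10^12)\<^sup>2 \<le> (real s)\<^sup>2 * S" using S by (simp add: power_mult_distrib)
  have "lin_var n p q c \<le> 2 * (20000 * S / real m) + S * sqrt S"
    using lin_var_one_sided[of c n p q, OF c] g(2) by (simp add: S_def)
  also have "2 * (20000 * S / real m) \<le> real s * S\<^sup>2 / (8 * 10^6)"
  proof -
    have "2 * 20000 * (8 * 10^6) \<le> real s * real m * S" using ym by simp
    then have "2 * 20000 * (8 * 10^6) * S \<le> real s * real m * S * S" using S by (intro mult_right_mono) auto
    then show ?thesis using m by (simp add: field_simps power2_eq_square)
  qed
  also have "S * sqrt S \<le> real s * S\<^sup>2 / (8 * 10^6)"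
  proof -
    have "8 * 10^6 \<le> real s * sqrt S" using sS by simp
    then have "8 * 10^6 * (S * sqrt S) \<le> real s * sqrt S * (S * sqrt S)" using S by (intro mult_right_mono) auto
    also have "\<dots> = real s * S * (sqrt S * sqrt S)" by (simp only: mult_ac)
    also have "\<dots> = real s * S\<^sup>2" using S by (simp add: power2_eq_square)
    finally show ?thesis by simp
  qed
  finally have lin: "lin_var n p q c \<le> real s * (S/2)\<^sup>2 / 10^6" by (simp add: power_divide)
  have "quad_var n p q c \<le> 8 * (400 / real m) + 2 * S"
    using quad_var_one_sided[of c n p q, OF c] g(3) by (simp add: S_def)
  also have "8 * (400 / real m) \<le> (real s)\<^sup>2 * S\<^sup>2 / (8 * 10^6)"
    using y2 m by (simp add: divide_simps)
  also have "2 * S \<le> (real s)\<^sup>2 * S\<^sup>2 / (8 * 10^6)"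
  proof -
    have "2 * (8 * 10^6) \<le> (real s)\<^sup>2 * S" using s2S by simp
    then have "2 * (8 * 10^6) * S \<le> (real s)\<^sup>2 * S * S" using S by (intro mult_right_mono) auto
    then show ?thesis by (simp add: power2_eq_square)
  qed
  finally have quad: "quad_var n p q c \<le> (real s)\<^sup>2 * (S/2)\<^sup>2 / 10^6" by (simp add: power_divide mult.commute)
  have th: "\<epsilon>\<^sup>2 / (50 * real n) \<le> S/2" using g(1) by simp
  have "measure_pmf.prob (closeness_stat s c p q) {T. S/2 \<le> \<bar>T - sep n p q c\<bar>} \<le> 1/16"
    by (rule closeness_stat_concentration[OF p q s _ lin quad]) (use S in simp)
  moreover have "measure_pmf.prob (closeness_test s (\<epsilon>\<^sup>2 / (50 * real n)) c p q) {b. b \<noteq> True} \<le>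
      measure_pmf.prob (closeness_stat s c p q) {T. S/2 \<le> \<bar>T - sep n p q c\<bar>}"
  proof -
    have "S / 2 \<le> \<bar>T - S\<bar>" if "\<not> T > \<epsilon>\<^sup>2 / (50 * real n)" for T using that th by arith
    then show ?thesis
      unfolding closeness_test_def measure_map_pmf S_def[symmetric] by (intro prob_mono) auto
  qed
  ultimately show ?thesis by linarith
qed

text \<open>The number \<open>t\<close> is the size of the batches to be classified later. Condition
  \<open>sm\<close> keeps the gap above half of the separation; \<open>tm\<close> and
  \<open>tsm\<close> control the linear and the quadratic part of the energy.\<close>

lemma prob_separating_weights:
  fixes p q :: "nat pmf"
  assumes p: "set_pmf p \<subseteq> {..<n}" and q: "set_pmf q \<subseteq> {..<n}" and e: "0 < \<epsilon>" and m: "0 < m" and n0: "0 < n"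
    and good: "good_flat n m \<epsilon> (mix p q) (\<lambda>i. pmf p i - pmf q i) c"
    and sm: "10^13 * real n \<le> real s * real m * \<epsilon>\<^sup>2"
    and tm: "10^13 * real n \<le> real t * real m * \<epsilon>\<^sup>2"
    and tsm: "10^13 * (real n)\<^sup>2 \<le> real t * real s * real m * \<epsilon>^4"
  shows "measure_pmf.prob (pair_pmf (replicate_pmf s p) (replicate_pmf s q))
    {z. \<not> (sep n p q c / 2 \<le> wt_gap n p q (wt c (fst z) (snd z)) \<and>
           4096 * wt_energy n p q (wt c (fst z) (snd z)) \<le> real t * (sep n p q c)\<^sup>2)} \<le> 1/32"
    and "0 < sep n p q c"
proof -
  define S where "S = sep n p q c"
  have s: "0 < s" using sm n0 by (cases "s = 0") auto
  have t: "0 < t" using tm n0 by (cases "t = 0") auto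
  have g: "\<epsilon>\<^sup>2 / (25 * real n) \<le> S"
    "(\<Sum>i<n. pmf (mix p q) i * ((c i)\<^sup>2 * (pmf p i - pmf q i)\<^sup>2)) \<le> 20000 * S / real m"
    "(\<Sum>i<n. (pmf (mix p q) i)\<^sup>2 * (c i)\<^sup>2) \<le> 400 / real m"
    using good by (auto simp: good_flat_def Let_def S_def sep_def)
  have "0 < \<epsilon>\<^sup>2 / (25 * real n)" using e n0 by simp
  with g(1) have S: "0 < S" by linarith
  then show "0 < sep n p q c" by (simp add: S_def)
  have "4 * 10^11 \<le> real s * real m * (\<epsilon>\<^sup>2 / (25 * real n))" using sm n0 by (simp add: field_simps)
  also have "\<dots> \<le> real s * real m * S" using g(1) by (intro mult_left_mono) auto
  finally have smS: "4 * 10^11 \<le> real s * real m * S" .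
  have "4 * 10^11 \<le> real t * real m * (\<epsilon>\<^sup>2 / (25 * real n))" using tm n0 by (simp add: field_simps)
  also have "\<dots> \<le> real t * real m * S" using g(1) by (intro mult_left_mono) auto
  finally have tmS: "4 * 10^11 \<le> real t * real m * S" .
  have "16 * 10^9 \<le> real t * real s * real m * (\<epsilon>^4 / (625 * (real n)\<^sup>2))" using tsm n0 by (simp add: field_simps)
  also have "\<epsilon>^4 / (625 * (real n)\<^sup>2) = (\<epsilon>\<^sup>2 / (25 * real n))\<^sup>2" by (simp add: power_divide power_mult_distrib)
  also have "real t * real s * real m * \<dots> \<le> real t * real s * real m * S\<^sup>2"
    using g(1) e by (intro mult_left_mono power_mono) auto
  finally have tsmS: "16 * 10^9 \<le> real t * real s * real m * S\<^sup>2" .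
  have "lin_var n p q c = 2 * (\<Sum>i<n. pmf (mix p q) i * ((c i)\<^sup>2 * (pmf p i - pmf q i)\<^sup>2))"
    by (simp add: lin_var_def pmf_mix sum_distrib_left)
  then have lin: "lin_var n p q c \<le> 40000 * S / real m" using g(2) by simp
  have "quad_var n p q c = 4 * (\<Sum>i<n. (pmf (mix p q) i)\<^sup>2 * (c i)\<^sup>2)"
    by (simp add: quad_var_def pmf_mix sum_distrib_left power_divide)
  then have quad: "quad_var n p q c \<le> 1600 / real m" using g(3) by simp
  let ?M = "pair_pmf (replicate_pmf s p) (replicate_pmf s q)"
  let ?w = "\<lambda>z. wt c (fst z) (snd z)"
  \<comment> \<open>At this energy an average of \<open>t\<close> fresh samples deviates by
    \<open>S/8\<close> with probability at most \<open>1/64\<close>, since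
    \<open>4096 = 64 * 64\<close>.\<close>
  define b where "b = real t * S\<^sup>2 / 4096"
  have b: "0 < b" using t S by (simp add: b_def)
  have "measure_pmf.prob ?M {z. S/2 \<le> \<bar>wt_gap n p q (?w z) - sep n p q c\<bar>} \<le> 2 * lin_var n p q c / (real s * (S/2)\<^sup>2)"
    by (rule prob_wt_gap[OF p q s]) (use S in simp)
  also have "\<dots> = 8 * lin_var n p q c / (real s * S\<^sup>2)" by (simp add: power_divide)
  also have "\<dots> \<le> 8 * (40000 * S / real m) / (real s * S\<^sup>2)"
    using lin by (intro divide_right_mono) auto
  also have "\<dots> = 320000 / (real s * real m * S)" using S by (simp add: power2_eq_square)
  also have "\<dots> \<le> 320000 / (4 * 10^11)" using smS by (intro divide_left_mono) auto
  finally have 1: "measure_pmf.prob ?M {z. S/2 \<le> \<bar>wt_gap n p q (?w z) - sep n p q c\<bar>} \<le> 1/64" by simp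
  have "measure_pmf.prob ?M {z. b \<le> wt_energy n p q (?w z)} \<le> 3 * (lin_var n p q c + quad_var n p q c / real s) / b"
    by (rule prob_wt_energy[OF p q s b])
  also have "\<dots> \<le> 3 * (40000 * S / real m + (1600 / real m) / real s) / b"
    using lin quad s b by (intro divide_right_mono mult_left_mono add_mono) auto
  also have "\<dots> = 12288 * (40000 / (real t * real m * S) + 1600 / (real t * real s * real m * S\<^sup>2))"
    using S s t m by (simp add: b_def field_simps power2_eq_square)
  also have "\<dots> \<le> 12288 * (40000 / (4 * 10^11) + 1600 / (16 * 10^9))"
    using tmS tsmS by (intro mult_left_mono add_mono divide_left_mono) auto
  finally have 2: "measure_pmf.prob ?M {z. b \<le> wt_energy n p q (?w z)} \<le> 1/64" by simp
  have "measure_pmf.prob ?M {z. \<not> (S / 2 \<le> wt_gap n p q (?w z) \<and> 4096 * wt_energy n p q (?w z) \<le> real t * S\<^sup>2)} \<le>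
    measure_pmf.prob ?M ({z. S/2 \<le> \<bar>wt_gap n p q (?w z) - sep n p q c\<bar>} \<union> {z. b \<le> wt_energy n p q (?w z)})"
  proof (intro prob_mono)
    have "S / 2 \<le> \<bar>x - S\<bar>" if "\<not> S / 2 \<le> x" for x using that by arith
    then show "{z. \<not> (S / 2 \<le> wt_gap n p q (?w z) \<and> 4096 * wt_energy n p q (?w z) \<le> real t * S\<^sup>2)} \<inter> set_pmf ?M
      \<subseteq> {z. S/2 \<le> \<bar>wt_gap n p q (?w z) - sep n p q c\<bar>} \<union> {z. b \<le> wt_energy n p q (?w z)}"
      unfolding S_def[symmetric] b_def by auto
  qed
  also have "\<dots> \<le> 1/64 + 1/64" by (rule prob_Un_le[OF 1 2])
  finally show "measure_pmf.prob ?M {z. \<not> (sep n p q c / 2 \<le> wt_gap n p q (?w z) \<and>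
     4096 * wt_energy n p q (?w z) \<le> real t * (sep n p q c)\<^sup>2)} \<le> 1/32" by (simp add: S_def)
qed

subsection \<open>The algorithm and its error probability\<close>

text \<open>The means of the learned functional under \<open>p\<close> and \<open>q\<close> are
  unknown, so the batches \<open>z'\<close> estimate them and the midpoint of the estimates serves
  as common threshold for all indices.\<close>

definition classify :: "nat \<Rightarrow> nat \<Rightarrow> nat \<Rightarrow> nat \<Rightarrow> nat \<Rightarrow> nat pmf \<Rightarrow> nat pmf \<Rightarrow> (nat \<Rightarrow> nat pmf) \<Rightarrow> nat set set pmf" where
  "classify L m s t k p q D =
     bind_pmf (replicate_pmf m (mix p q)) (\<lambda>u.
     bind_pmf (pair_pmf (replicate_pmf s p) (replicate_pmf s q)) (\<lambda>z.
     bind_pmf (pair_pmf (replicate_pmf t p) (replicate_pmf t q)) (\<lambda>z'.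
     bind_pmf (traverse_pmf (\<lambda>a. vote L (map_pmf (\<lambda>Z.
         avg (wt (flat_weight u) (fst z) (snd z)) Z >
         (avg (wt (flat_weight u) (fst z) (snd z)) (fst z') + avg (wt (flat_weight u) (fst z) (snd z)) (snd z')) / 2)
         (replicate_pmf t (D a)))) [0..<k]) (\<lambda>bs.
     return_pmf {{a. a < k \<and> bs ! a}, {a. a < k \<and> \<not> bs ! a}}))))"

lemma prob_vote_error:
  "measure_pmf.prob \<mu> {b. b \<noteq> v} \<le> 1/16 \<Longrightarrow> measure_pmf.prob (vote L \<mu>) {b. b \<noteq> v} \<le> 1 / 2 ^ L"
  unfolding vote_def by (rule prob_majority_error)

text \<open>Error budget: \<open>3/50\<close> for the flattening, \<open>1/32\<close> for the
  learned weights, \<open>1/64\<close> for the threshold and \<open>1 / 2 ^ L\<close> for each of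
  the \<open>k\<close> votes.\<close>

lemma classify_correct:
  fixes p q :: "nat pmf"
  assumes p: "set_pmf p \<subseteq> {..<n}" and q: "set_pmf q \<subseteq> {..<n}" and e: "0 < \<epsilon>" and m: "1 \<le> m" "m \<le> n"
    and far: "2 * \<epsilon> \<le> (\<Sum>i<n. \<bar>pmf p i - pmf q i\<bar>)"
    and sm: "10^13 * real n \<le> real s * real m * \<epsilon>\<^sup>2"
    and tm: "10^13 * real n \<le> real t * real m * \<epsilon>\<^sup>2"
    and tsm: "10^13 * (real n)\<^sup>2 \<le> real t * real s * real m * \<epsilon>^4"
    and part: "I \<union> J = {0..<k}" "I \<inter> J = {}" "\<And>a. a \<in> I \<Longrightarrow> D a = p" "\<And>a. a \<in> J \<Longrightarrow> D a = q"
  shows "measure_pmf.prob (classify L m s t k p q D) {R. R \<noteq> {I, J}} \<le>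
    3/50 + (1/32 + (1/64 + (real k * (1 / 2 ^ L) + 0)))"
  unfolding classify_def
proof (rule prob_bind_le[OF prob_good_flat[OF set_pmf_mix[OF p q] m e far]])
  fix u
  define c where "c = flat_weight u"
  define S where "S = sep n p q c"
  assume "u \<notin> {u. \<not> good_flat n m \<epsilon> (mix p q) (\<lambda>i. pmf p i - pmf q i) (flat_weight u)}"
  then have good: "good_flat n m \<epsilon> (mix p q) (\<lambda>i. pmf p i - pmf q i) c" by (simp add: c_def)
  have m0: "0 < m" "0 < n" using m by auto
  have t: "0 < t" using tm m0 by (cases "t = 0") auto
  note sw = prob_separating_weights[OF p q e m0 good sm tm tsm]
  have S: "0 < S" using sw(2) by (simp add: S_def)
  show "measure_pmf.prob (bind_pmf (pair_pmf (replicate_pmf s p) (replicate_pmf s q)) (\<lambda>z.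
     bind_pmf (pair_pmf (replicate_pmf t p) (replicate_pmf t q)) (\<lambda>z'.
     bind_pmf (traverse_pmf (\<lambda>a. vote L (map_pmf (\<lambda>Z.
         avg (wt (flat_weight u) (fst z) (snd z)) Z >
         (avg (wt (flat_weight u) (fst z) (snd z)) (fst z') + avg (wt (flat_weight u) (fst z) (snd z)) (snd z')) / 2)
         (replicate_pmf t (D a)))) [0..<k]) (\<lambda>bs.
     return_pmf {{a. a < k \<and> bs ! a}, {a. a < k \<and> \<not> bs ! a}})))) {R. R \<noteq> {I, J}} \<le>
     1/32 + (1/64 + (real k * (1 / 2 ^ L) + 0))"
    unfolding c_def[symmetric]
  proof (rule prob_bind_le[OF sw(1)])
    fix z
    define w where "w = wt c (fst z) (snd z)"
    define a b where "a = measure_pmf.expectation p w" and "b = measure_pmf.expectation q w"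
    assume "z \<notin> {z. \<not> (sep n p q c / 2 \<le> wt_gap n p q (wt c (fst z) (snd z)) \<and>
           4096 * wt_energy n p q (wt c (fst z) (snd z)) \<le> real t * (sep n p q c)\<^sup>2)}"
    then have gap: "S / 2 \<le> a - b" and en: "4096 * wt_energy n p q w \<le> real t * S\<^sup>2"
      by (auto simp: w_def S_def a_def b_def wt_gap_expectation[OF p q])
    have tS: "0 < real t * (S/8)\<^sup>2" using t S by simp
    have "64 * wt_energy n p q w \<le> real t * (S/8)\<^sup>2" using en by (simp add: power_divide)
    then have small: "wt_energy n p q w / (real t * (S/8)\<^sup>2) \<le> 1/64"
      using tS by (simp add: pos_divide_le_eq)
    have S8: "0 < S/8" using S by simp
    show "measure_pmf.prob (bind_pmf (pair_pmf (replicate_pmf t p) (replicate_pmf t q)) (\<lambda>z'.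
     bind_pmf (traverse_pmf (\<lambda>a. vote L (map_pmf (\<lambda>Z.
         avg (wt c (fst z) (snd z)) Z >
         (avg (wt c (fst z) (snd z)) (fst z') + avg (wt c (fst z) (snd z)) (snd z')) / 2)
         (replicate_pmf t (D a)))) [0..<k]) (\<lambda>bs.
     return_pmf {{a. a < k \<and> bs ! a}, {a. a < k \<and> \<not> bs ! a}}))) {R. R \<noteq> {I, J}} \<le>
     1/64 + (real k * (1 / 2 ^ L) + 0)"
      unfolding w_def[symmetric]
    proof (rule prob_bind_le[OF order_trans[OF prob_avg_pair[OF p q t S8, of w] small]])
      fix z'
      define \<theta> where "\<theta> = (avg w (fst z') + avg w (snd z')) / 2"
      assume "z' \<notin> {z. S/8 \<le> \<bar>avg w (fst z) - measure_pmf.expectation p w\<bar> \<or>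
        S/8 \<le> \<bar>avg w (snd z) - measure_pmf.expectation q w\<bar>}"
      then have "\<bar>avg w (fst z') - a\<bar> < S/8" "\<bar>avg w (snd z') - b\<bar> < S/8" by (auto simp: a_def b_def)
      \<comment> \<open>The means are at least \<open>S/2\<close> apart, so their midpoint is at
        least \<open>S/4\<close> away from either; a threshold error below \<open>S/8\<close> leaves
        a margin of \<open>S/8\<close> for every batch.\<close>
      then have \<theta>: "\<bar>\<theta> - (a + b) / 2\<bar> < S/8"
        unfolding \<theta>_def by (simp only: abs_less_iff) (simp add: field_simps)
      have batch: "measure_pmf.prob (map_pmf (\<lambda>Z. avg w Z > \<theta>) (replicate_pmf t (D x))) {v. v \<noteq> (x \<in> I)} \<le> 1/16"
        if x: "x \<in> set [0..<k]" for x
      proof -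
        have fin: "finite (set_pmf p)" "finite (set_pmf q)" using p q finite_subset by blast+
        have pI: "measure_pmf.prob (replicate_pmf t p) {Z. S/8 \<le> \<bar>avg w Z - a\<bar>} \<le> 1/64"
        proof -
          have "measure_pmf.prob (replicate_pmf t p) {Z. S/8 \<le> \<bar>avg w Z - a\<bar>} \<le>
            measure_pmf.expectation p (\<lambda>x. (w x)\<^sup>2) / (real t * (S/8)\<^sup>2)"
            unfolding a_def by (rule avg_chebyshev[OF fin(1) t S8])
          also have "\<dots> \<le> wt_energy n p q w / (real t * (S/8)\<^sup>2)"
            using expectation_sq_le_energy(1)[OF p] by (intro divide_right_mono) auto
          finally show ?thesis using small by linarith
        qed
        have pJ: "measure_pmf.prob (replicate_pmf t q) {Z. S/8 \<le> \<bar>avg w Z - b\<bar>} \<le> 1/64"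
        proof -
          have "measure_pmf.prob (replicate_pmf t q) {Z. S/8 \<le> \<bar>avg w Z - b\<bar>} \<le>
            measure_pmf.expectation q (\<lambda>x. (w x)\<^sup>2) / (real t * (S/8)\<^sup>2)"
            unfolding b_def by (rule avg_chebyshev[OF fin(2) t S8])
          also have "\<dots> \<le> wt_energy n p q w / (real t * (S/8)\<^sup>2)"
            using expectation_sq_le_energy(2)[OF q] by (intro divide_right_mono) auto
          finally show ?thesis using small by linarith
        qed
        show ?thesis
        proof (cases "x \<in> I")
          case True
          have "S/8 \<le> \<bar>y - a\<bar>" if "\<not> y > \<theta>" for y
          proof -
            have "\<theta> - (a + b) / 2 < S/8" using \<theta> by (simp only: abs_less_iff)
            then have "S/8 \<le> - (y - a)" using that gap by (simp add: field_simps)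
            then show ?thesis using abs_ge_minus_self[of "y - a"] by linarith
          qed
          then have "measure_pmf.prob (map_pmf (\<lambda>Z. avg w Z > \<theta>) (replicate_pmf t (D x))) {v. v \<noteq> (x \<in> I)} \<le>
            measure_pmf.prob (replicate_pmf t p) {Z. S/8 \<le> \<bar>avg w Z - a\<bar>}"
            unfolding measure_map_pmf part(3)[OF True] using True by (intro prob_mono) auto
          then show ?thesis using pI by linarith
        next
          case False
          have "x \<in> I \<union> J" unfolding part(1) using x by simp
          then have xJ: "x \<in> J" using False by simp
          have "S/8 \<le> \<bar>y - b\<bar>" if "y > \<theta>" for y
          proof -
            have "- (\<theta> - (a + b) / 2) < S/8" using \<theta> by (simp only: abs_less_iff)
            then have "S/8 \<le> y - b" using that gap by (simp add: field_simps)
            then show ?thesis using abs_ge_self[of "y - b"] by linarith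
          qed
          then have "measure_pmf.prob (map_pmf (\<lambda>Z. avg w Z > \<theta>) (replicate_pmf t (D x))) {v. v \<noteq> (x \<in> I)} \<le>
            measure_pmf.prob (replicate_pmf t q) {Z. S/8 \<le> \<bar>avg w Z - b\<bar>}"
            unfolding measure_map_pmf part(4)[OF xJ] using False by (intro prob_mono) auto
          then show ?thesis using pJ by linarith
        qed
      qed
      have tr: "measure_pmf.prob (traverse_pmf (\<lambda>a. vote L (map_pmf (\<lambda>Z. avg w Z > \<theta>) (replicate_pmf t (D a)))) [0..<k])
        {bs. \<not> list_all2 (\<lambda>x v. v = (x \<in> I)) [0..<k] bs} \<le> real (length [0..<k]) * (1 / 2 ^ L)"
        by (rule prob_traverse_error) (use prob_vote_error[OF batch] in auto)
      show "measure_pmf.prob (bind_pmf (traverse_pmf (\<lambda>a. vote L (map_pmf (\<lambda>Z.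
          avg w Z > (avg w (fst z') + avg w (snd z')) / 2)
         (replicate_pmf t (D a)))) [0..<k]) (\<lambda>bs.
         return_pmf {{a. a < k \<and> bs ! a}, {a. a < k \<and> \<not> bs ! a}})) {R. R \<noteq> {I, J}} \<le> real k * (1 / 2 ^ L) + 0"
        unfolding \<theta>_def[symmetric]
      proof (rule prob_bind_le)
        show "measure_pmf.prob (traverse_pmf (\<lambda>a. vote L (map_pmf (\<lambda>Z. avg w Z > \<theta>) (replicate_pmf t (D a)))) [0..<k])
          {bs. \<not> list_all2 (\<lambda>x v. v = (x \<in> I)) [0..<k] bs} \<le> real k * (1 / 2 ^ L)" using tr by simp
        fix bs assume "bs \<notin> {bs. \<not> list_all2 (\<lambda>x v. v = (x \<in> I)) [0..<k] bs}"
        then have bs: "bs ! i = (i \<in> I)" if "i < k" for i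
          using that by (auto simp: list_all2_conv_all_nth)
        have mem: "a < k \<longleftrightarrow> a \<in> I \<or> a \<in> J" for a
          using part(1) by (metis Un_iff atLeastLessThan_iff zero_le)
        have "{a. a < k \<and> bs ! a} = I" "{a. a < k \<and> \<not> bs ! a} = J"
          using bs mem part(2) by blast+
        then show "measure_pmf.prob (return_pmf {{a. a < k \<and> bs ! a}, {a. a < k \<and> \<not> bs ! a}}) {R. R \<noteq> {I, J}} \<le> 0"
          by simp
      qed simp
    qed simp
  qed simp
qed simp

text \<open>The truncation \<open>take N js\<close> is vacuous on the support, but the sample bound has to hold on
  all branches of the tree, including those of probability zero.\<close>

definition find_and_classify ::
    "nat \<Rightarrow> real \<Rightarrow> nat \<Rightarrow> nat \<Rightarrow> nat \<Rightarrow> nat \<Rightarrow> nat \<Rightarrow> nat \<Rightarrow> nat \<Rightarrow> (nat \<Rightarrow> nat pmf) \<Rightarrow> nat set set pmf" where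
  "find_and_classify L \<theta> N m1 s1 m s t k D =
     bind_pmf (replicate_pmf m1 (D 0)) (\<lambda>u.
     bind_pmf (replicate_pmf N (pmf_of_set {..<k})) (\<lambda>js.
     bind_pmf (traverse_pmf (\<lambda>j. vote L (closeness_test s1 \<theta> (flat_weight u) (D 0) (D j))) (take N js)) (\<lambda>bs.
     classify L m s t k (D 0) (D (SOME j. (j, True) \<in> set (zip js bs))) D)))"

text \<open>Markov's inequality at level \<open>1\<close> for the product of the indicators of the
  complement, whose mean factorizes by independence.\<close>

lemma prob_replicate_miss:
  fixes p :: "'a pmf"
  assumes fin: "finite (set_pmf p)"
  shows "measure_pmf.prob (replicate_pmf N p) {js. set js \<inter> Q = {}} \<le> (1 - measure_pmf.prob p Q) ^ N"
proof -
  have e1: "measure_pmf.expectation p (indicator (- Q)) = 1 - measure_pmf.prob p Q"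
    using measure_pmf.prob_compl[of Q p] by (simp add: Compl_eq_Diff_UNIV)
  have e2: "measure_pmf.prob p (- Q) = 1 - measure_pmf.prob p Q" using e1 by simp
  have "measure_pmf.expectation (replicate_pmf N p) (\<lambda>js. prod_list (map (indicator (- Q)) js) :: real) = (1 - measure_pmf.prob p Q) ^ N"
    by (induction N) (simp_all add: expectation_replicate_Suc[OF fin] e2 del: replicate_pmf.simps(2))
  then have "measure_pmf.prob (replicate_pmf N p) {js. 1 \<le> (prod_list (map (indicator (- Q)) js) :: real)} \<le> (1 - measure_pmf.prob p Q) ^ N / 1"
    by (intro markov_finite_pmf finite_set_replicate_pmf fin prod_list_nonneg) auto
  moreover have "1 \<le> (prod_list (map (indicator (- Q)) js) :: real)" if "set js \<inter> Q = {}" for js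
    using that by (induction js) auto
  then have "measure_pmf.prob (replicate_pmf N p) {js. set js \<inter> Q = {}} \<le>
     measure_pmf.prob (replicate_pmf N p) {js. 1 \<le> (prod_list (map (indicator (- Q)) js) :: real)}"
    by (intro prob_mono) auto
  ultimately show ?thesis by simp
qed

lemma dTV_lessThan:
  assumes "set_pmf p \<subseteq> {..<n}" "set_pmf q \<subseteq> {..<n}"
  shows "2 * dTV p q = (\<Sum>i<n. \<bar>pmf p i - pmf q i\<bar>)"
proof -
  have "infsum (\<lambda>x. \<bar>pmf p x - pmf q x\<bar>) UNIV = infsum (\<lambda>x. \<bar>pmf p x - pmf q x\<bar>) {..<n}"
    using assms by (intro infsum_cong_neutral) (auto, metis lessThan_iff set_pmf_iff subsetD)
  then show ?thesis by (simp add: dTV_def)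
qed

text \<open>All of \<open>J\<close> shares one distribution, so a single good event for the weights
  \<open>u\<close> serves all \<open>N\<close> tests. The budget is \<open>3/50\<close> for that
  event, \<open>1/50\<close> for sampling no index of \<open>J\<close>, the \<open>N\<close> votes,
  and the error of \<open>classify\<close>.\<close>

lemma find_and_classify_correct:
  assumes sup: "\<And>a. a < k \<Longrightarrow> set_pmf (D a) \<subseteq> {..<n}" and e: "0 < \<epsilon>" "\<epsilon> \<le> 1"
    and m1: "1 \<le> m1" "m1 \<le> n" and m: "1 \<le> m" "m \<le> n"
    and size: "10^13 * real n \<le> real s1 * sqrt (real m1) * \<epsilon>\<^sup>2"
    and sm: "10^13 * real n \<le> real s * real m * \<epsilon>\<^sup>2"
    and tm: "10^13 * real n \<le> real t * real m * \<epsilon>\<^sup>2"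
    and tsm: "10^13 * (real n)\<^sup>2 \<le> real t * real s * real m * \<epsilon>^4"
    and part: "I \<union> J = {0..<k}" "I \<inter> J = {}" "0 \<in> I" "J \<noteq> {}"
    and eqI: "\<And>a. a \<in> I \<Longrightarrow> D a = D 0" and eqJ: "\<And>a b. a \<in> J \<Longrightarrow> b \<in> J \<Longrightarrow> D a = D b"
    and far: "\<And>b. b \<in> J \<Longrightarrow> \<epsilon> \<le> dTV (D 0) (D b)"
    and miss: "(1 - real (card J) / real k) ^ N \<le> 1/50"
  shows "measure_pmf.prob (find_and_classify L (\<epsilon>\<^sup>2 / (50 * real n)) N m1 s1 m s t k D) {R. R \<noteq> {I, J}} \<le>
    3/50 + (1/50 + (real N * (1 / 2 ^ L) + (3/50 + (1/32 + (1/64 + (real k * (1 / 2 ^ L) + 0))))))"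
    (is "_ \<le> 3/50 + (1/50 + (?v + ?c))")
  unfolding find_and_classify_def
proof -
  obtain b where b: "b \<in> J" using part(4) by blast
  have bk: "b < k" using b part(1) by auto
  have "0 < k" using bk by simp
  have p: "set_pmf (D 0) \<subseteq> {..<n}" and q: "set_pmf (D b) \<subseteq> {..<n}" using sup bk \<open>0 < k\<close> by auto
  have tv: "2 * \<epsilon> \<le> (\<Sum>i<n. \<bar>pmf (D 0) i - pmf (D b) i\<bar>)"
    using far[OF b] dTV_lessThan[OF p q] by simp
  have c0: "0 \<le> ?c" by simp
  have fink: "finite (set_pmf (pmf_of_set {..<k}))" using \<open>0 < k\<close> by (subst set_pmf_of_set) auto
  have "measure_pmf.prob (pmf_of_set {..<k}) J = real (card J) / real k"
  proof -
    have "{..<k} \<inter> J = J" using part(1) by auto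
    then show ?thesis using \<open>0 < k\<close> by (subst measure_pmf_of_set) auto
  qed
  then have missp: "measure_pmf.prob (replicate_pmf N (pmf_of_set {..<k})) {js. set js \<inter> J = {}} \<le> 1/50"
    using prob_replicate_miss[OF fink, of N J] miss by simp
  show "measure_pmf.prob (bind_pmf (replicate_pmf m1 (D 0)) (\<lambda>u.
     bind_pmf (replicate_pmf N (pmf_of_set {..<k})) (\<lambda>js.
     bind_pmf (traverse_pmf (\<lambda>j. vote L (closeness_test s1 (\<epsilon>\<^sup>2 / (50 * real n)) (flat_weight u) (D 0) (D j))) (take N js)) (\<lambda>bs.
     classify L m s t k (D 0) (D (SOME j. (j, True) \<in> set (zip js bs))) D)))) {R. R \<noteq> {I, J}}
     \<le> 3/50 + (1/50 + (?v + ?c))"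
  proof (rule prob_bind_le[OF prob_good_flat[OF p m1 e(1) tv]])
    fix u
    assume "u \<notin> {u. \<not> good_flat n m1 \<epsilon> (D 0) (\<lambda>i. pmf (D 0) i - pmf (D b) i) (flat_weight u)}"
    then have good: "good_flat n m1 \<epsilon> (D 0) (\<lambda>i. pmf (D 0) i - pmf (D b) i) (flat_weight u)" by simp
    have m10: "0 < m1" "0 < n" using m1 by auto
    show "measure_pmf.prob (bind_pmf (replicate_pmf N (pmf_of_set {..<k})) (\<lambda>js.
     bind_pmf (traverse_pmf (\<lambda>j. vote L (closeness_test s1 (\<epsilon>\<^sup>2 / (50 * real n)) (flat_weight u) (D 0) (D j))) (take N js)) (\<lambda>bs.
     classify L m s t k (D 0) (D (SOME j. (j, True) \<in> set (zip js bs))) D))) {R. R \<noteq> {I, J}}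
     \<le> 1/50 + (?v + ?c)"
    proof (rule prob_bind_le[OF missp])
      fix js assume js: "js \<in> set_pmf (replicate_pmf N (pmf_of_set {..<k}))" "js \<notin> {js. set js \<inter> J = {}}"
      have lenjs: "length js = N" using js(1) by (rule length_replicate_pmf)
      have takejs: "take N js = js" using lenjs by simp
      have "set_pmf (pmf_of_set {..<k}) = {..<k}" using \<open>0 < k\<close> by (intro set_pmf_of_set) auto
      then have jsk: "set js \<subseteq> {..<k}" using js(1) by (auto simp: set_replicate_pmf lists_eq_set)
      have test: "measure_pmf.prob (closeness_test s1 (\<epsilon>\<^sup>2 / (50 * real n)) (flat_weight u) (D 0) (D j)) {v. v \<noteq> (j \<in> J)} \<le> 1/16"
        if "j \<in> set js" for j
      proof (cases "j \<in> J")
        case True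
        have "D j = D b" by (rule eqJ[OF True b])
        then show ?thesis using True
          closeness_test_far[OF p q e m10(1) m1(2) flat_weight_range good size] by simp
      next
        case False
        have "j \<in> I \<union> J" unfolding part(1) using that jsk by auto
        then have "j \<in> I" using False by simp
        then have "D j = D 0" by (rule eqI)
        then show ?thesis using False
          closeness_test_equal[OF p e(1) m10 good size] by simp
      qed
      have tr: "measure_pmf.prob (traverse_pmf (\<lambda>j. vote L (closeness_test s1 (\<epsilon>\<^sup>2 / (50 * real n)) (flat_weight u) (D 0) (D j))) js)
        {bs. \<not> list_all2 (\<lambda>j v. v = (j \<in> J)) js bs} \<le> real (length js) * (1 / 2 ^ L)"
        by (rule prob_traverse_error) (use prob_vote_error[OF test] in auto)
      show "measure_pmf.prob (bind_pmf (traverse_pmf (\<lambda>j. vote L (closeness_test s1 (\<epsilon>\<^sup>2 / (50 * real n)) (flat_weight u) (D 0) (D j))) (take N js)) (\<lambda>bs.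
        classify L m s t k (D 0) (D (SOME j. (j, True) \<in> set (zip js bs))) D)) {R. R \<noteq> {I, J}} \<le> ?v + ?c"
        unfolding takejs
      proof (rule prob_bind_le[OF tr[unfolded lenjs] c0])
        fix bs assume "bs \<notin> {bs. \<not> list_all2 (\<lambda>j v. v = (j \<in> J)) js bs}"
        then have bs: "list_all2 (\<lambda>j v. v = (j \<in> J)) js bs" by simp
        \<comment> \<open>Some sampled index lies in \<open>J\<close> and was voted
          \<open>True\<close>, so the choice operator has a witness; as all votes are right,
          whatever it picks lies in \<open>J\<close>.\<close>
        define j where "j = (SOME j. (j, True) \<in> set (zip js bs))"
        obtain j0 where j0: "j0 \<in> set js" "j0 \<in> J" using js(2) by auto
        then obtain i where i: "i < length js" "js ! i = j0" by (auto simp: in_set_conv_nth)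
        have "bs ! i = True" "i < length bs" using bs i j0 by (auto simp: list_all2_conv_all_nth)
        then have "(j0, True) \<in> set (zip js bs)" using i by (force simp: set_zip)
        then have "(j, True) \<in> set (zip js bs)" unfolding j_def by (rule someI)
        then have jJ: "j \<in> J" using bs by (auto simp: set_zip list_all2_conv_all_nth)
        then have Dj: "D j = D b" by (rule eqJ[OF _ b])
        have "measure_pmf.prob (classify L m s t k (D 0) (D b) D) {R. R \<noteq> {I, J}} \<le> ?c"
          by (rule classify_correct[OF p q e(1) m tv sm tm tsm part(1,2) eqI eqJ[OF _ b]])
        then show "measure_pmf.prob (classify L m s t k (D 0) (D (SOME j. (j, True) \<in> set (zip js bs))) D) {R. R \<noteq> {I, J}} \<le> ?c"
          by (simp add: j_def[symmetric] Dj)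
      qed
    qed simp
  qed simp
qed

section \<open>Worst-case sample counts\<close>

lemma implementable_pair:
  assumes "implementable \<mu> c" "implementable \<nu> c'"
  shows "implementable (\<lambda>D. pair_pmf (\<mu> D) (\<nu> D)) (c + c')"
proof -
  have "implementable (\<lambda>D. bind_pmf (\<mu> D) (\<lambda>x. bind_pmf (\<nu> D) (\<lambda>y. return_pmf (x, y)))) (c + (c' + 0))"
    by (intro implementable_bind assms implementable_return)
  then show ?thesis by (simp add: pair_pmf_def)
qed

lemma implementable_draws: "implementable (\<lambda>D. replicate_pmf m (D a)) (real m)"
  using implementable_replicate[OF implementable_sample, of m a] by simp

lemma implementable_vote:
  "implementable \<mu> c \<Longrightarrow> implementable (\<lambda>D. vote L (\<mu> D)) (real L * c)"
  unfolding vote_def by (intro implementable_map implementable_replicate)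

lemma implementable_mix: "implementable (\<lambda>D. mix (D a) (D b)) 1"
proof -
  have "implementable (\<lambda>D. bind_pmf (bernoulli_pmf (1/2)) (\<lambda>x. D (if x then a else b))) (0 + 1)"
    by (intro implementable_bind implementable_rand implementable_sample)
  then show ?thesis by (simp add: mix_def if_distrib)
qed

lemma implementable_closeness_test:
  "implementable (\<lambda>D. closeness_test s \<theta> c (D a) (D b)) (4 * real s)"
proof -
  have "implementable (\<lambda>D. closeness_test s \<theta> c (D a) (D b)) ((real s + real s) + (real s + real s))"
    unfolding closeness_test_def closeness_stat_def
    by (intro implementable_map implementable_bind implementable_pair implementable_draws)
  then show ?thesis by simp
qed

lemma implementable_classify:
  "implementable (\<lambda>D. classify L m s t k (D a) (D b) D) (real m + 2 * real s + 2 * real t + real k * (real L * real t))"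
proof -
  have "implementable (\<lambda>D. classify L m s t k (D a) (D b) D)
     (real m * 1 + ((real s + real s) + ((real t + real t) + (real (length [0..<k]) * (real L * real t) + 0))))"
    unfolding classify_def
    by (intro implementable_map implementable_bind implementable_pair implementable_draws implementable_traverse
      implementable_vote implementable_return implementable_replicate implementable_mix)
  then show ?thesis by (simp add: add.assoc)
qed

lemma implementable_find_and_classify:
  "implementable (find_and_classify L \<theta> N m1 s1 m s t k)
    (real m1 + real N * (real L * (4 * real s1)) + (real m + 2 * real s + 2 * real t + real k * (real L * real t)))"
    (is "implementable _ (real m1 + ?T + ?c)")
proof -
  have cl: "implementable (\<lambda>D. bind_pmf (traverse_pmf (\<lambda>j. vote L (closeness_test s1 \<theta> (flat_weight u) (D 0) (D j))) (take N js)) (\<lambda>bs.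
     classify L m s t k (D 0) (D (SOME j. (j, True) \<in> set (zip js bs))) D)) (?T + ?c)" for u js
    by (rule implementable_mono[where c = "real (length (take N js)) * (real L * (4 * real s1)) + ?c"],
        intro implementable_bind implementable_traverse implementable_vote implementable_closeness_test implementable_classify,
        intro add_right_mono mult_right_mono, simp_all)
  have "implementable (\<lambda>D. find_and_classify L \<theta> N m1 s1 m s t k D) (real m1 + (0 + (?T + ?c)))"
    unfolding find_and_classify_def
    by (intro implementable_bind[OF implementable_draws] implementable_bind[OF implementable_rand] cl)
  then show ?thesis by (simp add: add.assoc)
qed

subsection \<open>Choice of the sample sizes\<close>

lemma nat_ceiling_bounds:
  fixes y :: real
  assumes "0 \<le> y"
  shows "y \<le> real (nat \<lceil>y\<rceil>)" "real (nat \<lceil>y\<rceil>) \<le> y + 1"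
  using assms by linarith+

text \<open>With \<open>s\<close> about \<open>x / sqrt m\<close>, the value
  \<open>(K * x) powr (2/3)\<close> balances \<open>m\<close> against \<open>K * s\<close>. If it
  exceeds \<open>n\<close>, the cap \<open>m = n\<close> applies and \<open>K * s\<close> is
  governed by the second entry of the maximum.\<close>

lemma find_parameters:
  fixes n :: nat and \<epsilon> K :: real
  assumes n: "1 \<le> n" and e: "0 < \<epsilon>" "\<epsilon> \<le> 1" and K: "1 \<le> K"
  defines "M \<equiv> max ((K * (real n / \<epsilon>\<^sup>2)) powr (2/3)) (K * sqrt (real n) / \<epsilon>\<^sup>2)"
  obtains m s :: nat where "1 \<le> m" "m \<le> n" "10^13 * real n \<le> real s * sqrt (real m) * \<epsilon>\<^sup>2"
    "real m \<le> 2 * M" "K * real s \<le> (10^13 + 1) * M"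
proof -
  define x where "x = real n / \<epsilon>\<^sup>2"
  define y where "y = (K * x) powr (2/3)"
  define m where "m = min n (nat \<lceil>y\<rceil>)"
  define s where "s = nat \<lceil>10^13 * x / sqrt (real m)\<rceil>"
  have e2: "0 < \<epsilon>\<^sup>2" "\<epsilon>\<^sup>2 \<le> 1" using e by (auto simp: power_le_one)
  have xn: "real n \<le> x" using e2 n by (simp add: x_def field_simps mult_left_le)
  have x1: "1 \<le> x" using xn n by linarith
  have Kx: "1 \<le> K * x" using K x1 by (simp add: mult_ge1_I)
  have y1: "1 \<le> y" using Kx by (simp add: y_def ge_one_powr_ge_zero)
  have m1: "1 \<le> m" using n y1 by (simp add: m_def) linarith
  have mn: "m \<le> n" by (simp add: m_def)
  have "real m \<le> y + 1"
  proof -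
    have "real m \<le> real (nat \<lceil>y\<rceil>)" by (simp add: m_def)
    also have "\<dots> \<le> y + 1" using y1 by linarith
    finally show ?thesis .
  qed
  then have m2: "real m \<le> 2 * M" using y1 by (simp add: M_def y_def x_def)
  have sq: "0 < sqrt (real m)" "sqrt (real m) \<le> real m"
    using m1 by (auto intro!: real_le_lsqrt simp: power2_eq_square)
  have s_ge: "10^13 * x / sqrt (real m) \<le> real s" unfolding s_def by linarith
  then have "10^13 * x \<le> real s * sqrt (real m)" using sq by (simp add: pos_divide_le_eq)
  then have "10^13 * x * \<epsilon>\<^sup>2 \<le> real s * sqrt (real m) * \<epsilon>\<^sup>2" by (intro mult_right_mono) auto
  then have size: "10^13 * real n \<le> real s * sqrt (real m) * \<epsilon>\<^sup>2" using e2 by (simp add: x_def)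
  have "sqrt (real m) \<le> x" using sq mn xn by linarith
  \<comment> \<open>This absorbs the rounding of \<open>s\<close> and is the source of the
    \<open>+ 1\<close> in \<open>10^13 + 1\<close>.\<close>
  then have one: "1 \<le> x / sqrt (real m)" using sq by (simp add: pos_le_divide_eq)
  have "0 \<le> 10^13 * x / sqrt (real m)" using x1 by simp
  then have "real s \<le> 10^13 * x / sqrt (real m) + 1" unfolding s_def by linarith
  then have "real s \<le> 10^13 * (x / sqrt (real m)) + x / sqrt (real m)" using one by simp
  then have "real s \<le> (10^13 + 1) * (x / sqrt (real m))" by (simp only: distrib_right mult_1)
  then have "K * real s \<le> K * ((10^13 + 1) * (x / sqrt (real m)))" using K by (intro mult_left_mono) auto
  also have "\<dots> = (10^13 + 1) * (K * x / sqrt (real m))" by (simp add: mult_ac)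
  also have "\<dots> \<le> (10^13 + 1) * M"
  proof (intro mult_left_mono)
    show "K * x / sqrt (real m) \<le> M"
    proof (cases "m = n")
      case True
      have "K * x / sqrt (real m) = K / \<epsilon>\<^sup>2 * (real n / sqrt (real n))" using True by (simp add: x_def)
      also have "real n / sqrt (real n) = sqrt (real n)" by (rule real_div_sqrt) simp
      finally show ?thesis by (simp add: M_def)
    next
      case False
      then have "m = nat \<lceil>y\<rceil>" by (auto simp: m_def)
      then have my: "y \<le> real m" by linarith
      have "K * x / sqrt (real m) \<le> K * x / sqrt y"
        using my y1 Kx by (intro divide_left_mono mult_pos_pos) auto
      also have "sqrt y = (K * x) powr (1/3)" using Kx by (simp add: y_def powr_half_sqrt[symmetric] powr_powr)
      also have "K * x / (K * x) powr (1/3) = (K * x) powr (1 - 1/3)" using Kx powr_diff[of "K * x" 1 "1/3"] by simp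
      also have "\<dots> = y" by (simp add: y_def)
      finally show ?thesis by (simp add: M_def y_def x_def)
    qed
  qed simp
  finally show ?thesis using that m1 mn size m2 by blast
qed

text \<open>Separates constants from balancing: real sizes meeting the conditions with constant
  \<open>1\<close> are multiplied by \<open>10^13\<close> and rounded up, the lower bounds
  \<open>1\<close> absorbing the rounding.\<close>

lemma classify_parameters_scale:
  fixes n m :: nat and \<epsilon> s0 t0 :: real
  assumes e: "0 < \<epsilon>" and s0: "1 \<le> s0" and t0: "1 \<le> t0"
    and sm: "real n / \<epsilon>\<^sup>2 \<le> s0 * real m" and tm: "real n / \<epsilon>\<^sup>2 \<le> t0 * real m"
    and tsm: "(real n / \<epsilon>\<^sup>2)\<^sup>2 \<le> t0 * s0 * real m"
  obtains s t :: nat where "10^13 * real n \<le> real s * real m * \<epsilon>\<^sup>2"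
    "10^13 * real n \<le> real t * real m * \<epsilon>\<^sup>2"
    "10^13 * (real n)\<^sup>2 \<le> real t * real s * real m * \<epsilon>^4"
    "real s \<le> (10^13 + 1) * s0" "real t \<le> (10^13 + 1) * t0"
proof -
  define s where "s = nat \<lceil>10^13 * s0\<rceil>"
  define t where "t = nat \<lceil>10^13 * t0\<rceil>"
  have e2: "0 < \<epsilon>\<^sup>2" using e by simp
  have s: "10^13 * s0 \<le> real s" "real s \<le> (10^13 + 1) * s0"
    using s0 nat_ceiling_bounds[of "10^13 * s0", folded s_def] by auto
  have t: "10^13 * t0 \<le> real t" "real t \<le> (10^13 + 1) * t0"
    using t0 nat_ceiling_bounds[of "10^13 * t0", folded t_def] by auto
  have *: "10^13 * real n \<le> real u * real m * \<epsilon>\<^sup>2"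
    if "10^13 * u0 \<le> real u" "real n / \<epsilon>\<^sup>2 \<le> u0 * real m" for u u0
  proof -
    have "10^13 * (real n / \<epsilon>\<^sup>2) \<le> 10^13 * (u0 * real m)" using that(2) by simp
    also have "\<dots> = (10^13 * u0) * real m" by simp
    also have "\<dots> \<le> real u * real m" using that(1) by (intro mult_right_mono) auto
    finally have "10^13 * (real n / \<epsilon>\<^sup>2) * \<epsilon>\<^sup>2 \<le> real u * real m * \<epsilon>\<^sup>2" by (intro mult_right_mono) auto
    then show ?thesis using e2 by simp
  qed
  have "10^13 * (real n / \<epsilon>\<^sup>2)\<^sup>2 \<le> 10^13 * (t0 * s0 * real m)" using tsm by simp
  also have "\<dots> = 10^13 * t0 * s0 * real m" by simp
  also have "\<dots> \<le> real t * real s * real m"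
    using s t s0 t0 by (intro mult_right_mono mult_mono) auto
  finally have "10^13 * (real n / \<epsilon>\<^sup>2)\<^sup>2 * \<epsilon>^4 \<le> real t * real s * real m * \<epsilon>^4" by (intro mult_right_mono) auto
  moreover have "(real n / \<epsilon>\<^sup>2)\<^sup>2 * \<epsilon>^4 = (real n)\<^sup>2" using e by (simp add: power_divide)
  ultimately have "10^13 * (real n)\<^sup>2 \<le> real t * real s * real m * \<epsilon>^4" by simp
  then show ?thesis using that *[OF s(1) sm] *[OF t(1) tm] s(2) t(2) by blast
qed

text \<open>The sizes balance \<open>m\<close>, \<open>s\<close> and \<open>\<kappa> * t\<close>
  under \<open>x \<le> s * m\<close>, \<open>x \<le> t * m\<close>,
  \<open>x\<^sup>2 \<le> t * s * m\<close> and \<open>m \<le> n\<close>. In the three regimes all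
  three quantities are balanced, \<open>m\<close> is capped at \<open>n\<close>, or in addition
  \<open>x \<le> t * m\<close> becomes tight.\<close>

lemma classify_parameters:
  fixes n :: nat and \<epsilon> \<kappa> :: real
  assumes n: "1 \<le> n" and e: "0 < \<epsilon>" "\<epsilon> \<le> 1" and \<kappa>: "1 \<le> \<kappa>"
  defines "R \<equiv> (if real n \<ge> \<kappa> / \<epsilon>^4 then ((real n)\<^sup>2 * \<kappa> / \<epsilon>^4) powr (1/3)
     else if real n \<ge> \<kappa> then sqrt (real n * \<kappa>) / \<epsilon>\<^sup>2 else \<kappa> / \<epsilon>\<^sup>2)"
  obtains m s t :: nat where "1 \<le> m" "m \<le> n"
    "10^13 * real n \<le> real s * real m * \<epsilon>\<^sup>2"
    "10^13 * real n \<le> real t * real m * \<epsilon>\<^sup>2"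
    "10^13 * (real n)\<^sup>2 \<le> real t * real s * real m * \<epsilon>^4"
    "real m \<le> 2 * R" "real s \<le> (10^13 + 1) * R" "\<kappa> * real t \<le> (10^13 + 1) * R"
proof -
  define x where "x = real n / \<epsilon>\<^sup>2"
  have e2: "0 < \<epsilon>\<^sup>2" "\<epsilon>\<^sup>2 \<le> 1" using e by (auto simp: power_le_one)
  have xn: "real n \<le> x" using e2 n by (simp add: x_def field_simps mult_left_le)
  have x1: "1 \<le> x" using xn n by linarith
  have n1: "1 \<le> real n" using n by simp
  have "\<exists>m s0 t0. 1 \<le> m \<and> m \<le> n \<and> 1 \<le> s0 \<and> 1 \<le> t0 \<and> x \<le> s0 * real m \<and> x \<le> t0 * real m \<and>
     x\<^sup>2 \<le> t0 * s0 * real m \<and> real m \<le> 2 * R \<and> s0 \<le> R \<and> \<kappa> * t0 \<le> R"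
  proof -
    consider (1) "real n \<ge> \<kappa> / \<epsilon>^4" | (2) "\<not> real n \<ge> \<kappa> / \<epsilon>^4" "real n \<ge> \<kappa>"
      | (3) "\<not> real n \<ge> \<kappa> / \<epsilon>^4" "\<not> real n \<ge> \<kappa>" by blast
    then show ?thesis
    proof cases
      case 1
      have x2: "x\<^sup>2 * \<kappa> = (real n)\<^sup>2 * \<kappa> / \<epsilon>^4" by (simp add: x_def power_divide)
      have x2\<kappa>: "1 \<le> x\<^sup>2 * \<kappa>" using x1 \<kappa> by (simp add: mult_ge1_I one_le_power)
      \<comment> \<open>With \<open>m\<close> and \<open>s\<close> about \<open>R\<close> and
        \<open>t\<close> equal to \<open>R / \<kappa>\<close>, equality in
        \<open>x\<^sup>2 \<le> t * s * m\<close> means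
        \<open>R ^ 3 = x\<^sup>2 * \<kappa>\<close>.\<close>
      have Rdef: "R = (x\<^sup>2 * \<kappa>) powr (1/3)" using 1 by (simp add: R_def x2)
      have R1: "1 \<le> R" using x2\<kappa> by (simp add: Rdef ge_one_powr_ge_zero)
      have R3: "R ^ 3 = x\<^sup>2 * \<kappa>"
      proof -
        have "R ^ 3 = R powr 3" using R1 by (simp add: powr_numeral)
        also have "\<dots> = x\<^sup>2 * \<kappa>" unfolding Rdef powr_powr using x2\<kappa> by simp
        finally show ?thesis .
      qed
      \<comment> \<open>The condition of this regime says precisely that the balanced value does not
        exceed the cap \<open>n\<close>.\<close>
      have "R ^ 3 \<le> real n ^ 3"
      proof -
        have "R ^ 3 = (real n)\<^sup>2 * (\<kappa> / \<epsilon>^4)" by (simp add: R3 x2)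
        also have "\<dots> \<le> (real n)\<^sup>2 * real n" using 1 by (intro mult_left_mono) auto
        finally show ?thesis by (simp add: power3_eq_cube power2_eq_square)
      qed
      then have Rn: "R \<le> real n" using R1 by (simp add: power_mono_iff)
      have xR2: "x \<le> R\<^sup>2"
      proof -
        have "x ^ 3 \<le> x ^ 4" using x1 by (intro power_increasing) auto
        also have "\<dots> = (x\<^sup>2 * 1)\<^sup>2" by simp
        also have "\<dots> \<le> (x\<^sup>2 * \<kappa>)\<^sup>2" using \<kappa> by (intro power_mono mult_left_mono) auto
        also have "\<dots> = (R\<^sup>2) ^ 3" by (simp add: R3[symmetric])
        finally have "x ^ Suc 2 \<le> (R\<^sup>2) ^ Suc 2" by (simp only: numeral_3_eq_3 numeral_2_eq_2)
        then show ?thesis by (rule power_le_imp_le_base) simp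
      qed
      define m where "m = nat \<lceil>R\<rceil>"
      have m: "R \<le> real m" "real m \<le> R + 1" using R1 unfolding m_def by linarith+
      have mn: "m \<le> n" using Rn by (simp add: m_def ceiling_le_iff)
      have m1: "1 \<le> m" using m(1) R1 by linarith
      define t0 where "t0 = x\<^sup>2 / R\<^sup>2"
      have Rx: "R \<le> x" using Rn xn by linarith
      have R2pos: "0 < R\<^sup>2" using R1 by simp
      have t1: "1 \<le> t0" using Rx R1 R2pos by (simp add: t0_def power_mono)
      have "x \<le> R * real m"
        using xR2 mult_left_mono[OF m(1) order_trans[OF zero_le_one R1]] by (simp add: power2_eq_square)
      moreover have "x \<le> t0 * real m"
      proof -
        have "x * R \<le> x * x" using Rx x1 by (intro mult_left_mono) auto
        then have "x \<le> x\<^sup>2 / R" using R1 by (simp add: pos_le_divide_eq power2_eq_square)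
        also have "\<dots> = t0 * R" using R1 by (simp add: t0_def power2_eq_square)
        also have "\<dots> \<le> t0 * real m" using m(1) t1 by (intro mult_left_mono) auto
        finally show ?thesis .
      qed
      moreover have "x\<^sup>2 \<le> t0 * R * real m"
      proof -
        have "x\<^sup>2 = t0 * R * R" using R1 by (simp add: t0_def power2_eq_square)
        also have "\<dots> \<le> t0 * R * real m" using m(1) t1 R1 by (intro mult_left_mono) auto
        finally show ?thesis .
      qed
      moreover have "\<kappa> * t0 = R"
      proof -
        have "\<kappa> * t0 = R ^ 3 / R\<^sup>2" by (simp add: R3 t0_def)
        also have "\<dots> = R" using R1 by (simp add: power3_eq_cube power2_eq_square)
        finally show ?thesis .
      qed
      moreover have "real m \<le> 2 * R" using m R1 by linarith
      ultimately show ?thesis using m1 mn R1 t1 by - (rule exI[of _ m], rule exI[of _ R], rule exI[of _ t0], auto)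
    next
      case 2
      have R: "R = sqrt (real n * \<kappa>) / \<epsilon>\<^sup>2" using 2 by (simp add: R_def)
      \<comment> \<open>Now \<open>m = n\<close>; equating \<open>s\<close> with
        \<open>\<kappa> * t\<close> in \<open>t * s * n = x\<^sup>2\<close> gives this
        value.\<close>
      define t0 where "t0 = sqrt (real n / \<kappa>) / \<epsilon>\<^sup>2"
      have "1 \<le> real n * \<kappa>" using n1 \<kappa> by (simp add: mult_ge1_I)
      then have sq1: "1 \<le> sqrt (real n * \<kappa>)" by simp
      have "1 \<le> real n / \<kappa>" using 2 \<kappa> by simp
      then have sq2: "1 \<le> sqrt (real n / \<kappa>)" by simp
      have R1: "1 / \<epsilon>\<^sup>2 \<le> R" unfolding R using sq1 by (intro divide_right_mono) auto
      have t1: "1 / \<epsilon>\<^sup>2 \<le> t0" unfolding t0_def using sq2 by (intro divide_right_mono) auto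
      have i1: "1 \<le> 1 / \<epsilon>\<^sup>2" using e2 by simp
      have xeq: "x = 1 / \<epsilon>\<^sup>2 * real n" by (simp add: x_def)
      have "x \<le> R * real n" "x \<le> t0 * real n" unfolding xeq using R1 t1 by (intro mult_right_mono; simp)+
      moreover have "x\<^sup>2 \<le> t0 * R * real n"
      proof -
        have "sqrt (real n / \<kappa>) * sqrt (real n * \<kappa>) = sqrt ((real n)\<^sup>2)"
          using \<kappa> by (simp add: real_sqrt_mult[symmetric] power2_eq_square)
        then have "t0 * R = real n / (\<epsilon>\<^sup>2)\<^sup>2" by (simp add: t0_def R power2_eq_square)
        then show ?thesis by (simp add: x_def power_divide power2_eq_square)
      qed
      moreover have "\<kappa> * t0 = R"
      proof -
        have "\<kappa> * sqrt (real n / \<kappa>) = sqrt (\<kappa>\<^sup>2 * (real n / \<kappa>))" unfolding real_sqrt_mult using \<kappa> by simp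
        also have "\<kappa>\<^sup>2 * (real n / \<kappa>) = real n * \<kappa>" using \<kappa> by (simp add: power2_eq_square)
        finally show ?thesis by (simp add: R t0_def)
      qed
      moreover have "real n \<le> 2 * R"
      proof -
        have "real n * \<epsilon>^4 \<le> \<kappa>" using 2(1) e by (simp add: field_simps)
        then have "real n * (real n * \<epsilon>^4) \<le> real n * \<kappa>" by (intro mult_left_mono) auto
        then have "sqrt (real n * (real n * \<epsilon>^4)) \<le> sqrt (real n * \<kappa>)" by simp
        moreover have "real n * (real n * \<epsilon>^4) = (real n * \<epsilon>\<^sup>2)\<^sup>2" by (simp add: power2_eq_square power4_eq_xxxx)
        ultimately have "real n * \<epsilon>\<^sup>2 \<le> sqrt (real n * \<kappa>)" by simp
        then have "real n \<le> R" unfolding R using e2 by (simp add: pos_le_divide_eq)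
        then show ?thesis by simp
      qed
      ultimately show ?thesis using n R1 t1 i1 by - (rule exI[of _ n], rule exI[of _ R], rule exI[of _ t0], auto)
    next
      case 3
      have R: "R = \<kappa> / \<epsilon>\<^sup>2" using 3 by (simp add: R_def)
      \<comment> \<open>Again \<open>m = n\<close>, but \<open>x \<le> t * m\<close> forces
        \<open>t\<close> to be at least \<open>x / n\<close>, which is this value.\<close>
      define t0 where "t0 = 1 / \<epsilon>\<^sup>2"
      have i1: "1 \<le> t0" using e2 by (simp add: t0_def)
      have Rt: "R = \<kappa> * t0" by (simp add: R t0_def)
      have tR: "t0 \<le> R" unfolding Rt using \<kappa> i1 mult_right_mono[of 1 \<kappa> t0] by simp
      have xeq: "x = t0 * real n" by (simp add: x_def t0_def)
      have "x \<le> R * real n" unfolding xeq using tR by (intro mult_right_mono) auto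
      moreover have "x\<^sup>2 \<le> t0 * R * real n"
      proof -
        have "x\<^sup>2 = (t0 * t0 * real n) * real n" by (simp add: xeq power2_eq_square)
        also have "\<dots> \<le> (t0 * t0 * real n) * \<kappa>" using 3 i1 by (intro mult_left_mono) auto
        finally show ?thesis by (simp add: Rt mult_ac)
      qed
      moreover have "real n \<le> 2 * R"
      proof -
        have "real n \<le> \<kappa> * 1" using 3 by simp
        also have "\<dots> \<le> R" unfolding Rt using i1 \<kappa> by (intro mult_left_mono) auto
        finally show ?thesis using \<kappa> i1 tR by linarith
      qed
      ultimately show ?thesis using n i1 tR order_trans[OF i1 tR] eq_refl[OF Rt[symmetric]] eq_refl[OF xeq] by - (rule exI[of _ n], rule exI[of _ R], rule exI[of _ t0], auto)
    qed
  qed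
  then obtain m s0 t0 where p: "1 \<le> m" "m \<le> n" "1 \<le> s0" "1 \<le> t0" "x \<le> s0 * real m" "x \<le> t0 * real m"
     "x\<^sup>2 \<le> t0 * s0 * real m" "real m \<le> 2 * R" "s0 \<le> R" "\<kappa> * t0 \<le> R" by blast
  obtain s t where st: "10^13 * real n \<le> real s * real m * \<epsilon>\<^sup>2"
    "10^13 * real n \<le> real t * real m * \<epsilon>\<^sup>2"
    "10^13 * (real n)\<^sup>2 \<le> real t * real s * real m * \<epsilon>^4"
    "real s \<le> (10^13 + 1) * s0" "real t \<le> (10^13 + 1) * t0"
    by (rule classify_parameters_scale[OF e(1) p(3,4) p(5-7)[unfolded x_def]])
  have "real s \<le> (10^13 + 1) * R" using st(4) p(9) by simp
  moreover have "\<kappa> * real t \<le> (10^13 + 1) * R"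
  proof -
    have "\<kappa> * real t \<le> \<kappa> * ((10^13 + 1) * t0)" using st(5) \<kappa> by (intro mult_left_mono) auto
    also have "\<dots> = (10^13 + 1) * (\<kappa> * t0)" by simp
    also have "\<dots> \<le> (10^13 + 1) * R" using p(10) by (intro mult_left_mono) auto
    finally show ?thesis .
  qed
  ultimately show ?thesis using that p(1,2,8) st(1-3) by blast
qed


section \<open>Assembly of the algorithm\<close>

text \<open>Index \<open>0\<close> may belong to the smaller or to the larger cluster, and one
  algorithm must serve both cases; hence the other cluster \<open>J\<close> is only assumed to have
  at least \<open>r\<close> elements.\<close>

lemma clustering_alg_exists:
  fixes n k r :: nat and \<epsilon> :: real
  assumes n: "1 \<le> n" and k: "2 \<le> k" and r: "1 \<le> r" "r \<le> k" and e: "0 < \<epsilon>" "\<epsilon> \<le> 1"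
  obtains A where "samples_le A (10^16 * (M_bound n k \<epsilon> r * ln (real k) + R_bound n k \<epsilon>))"
    "\<And>D I J. \<lbrakk>\<And>a. a < k \<Longrightarrow> set_pmf (D a) \<subseteq> {..<n}; I \<union> J = {0..<k}; I \<inter> J = {}; 0 \<in> I; r \<le> card J;
      \<And>a. a \<in> I \<Longrightarrow> D a = D 0; \<And>a b. a \<in> J \<Longrightarrow> b \<in> J \<Longrightarrow> D a = D b;
      \<And>b. b \<in> J \<Longrightarrow> \<epsilon> \<le> dTV (D 0) (D b)\<rbrakk> \<Longrightarrow>
      measure_pmf.prob (run A D) {R. R \<noteq> {I, J}} \<le> 1/3"
proof -
  define lk where "lk = ln (real k)"
  define \<kappa> where "\<kappa> = real k * lk"
  define K where "K = real k / real r"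
  define M where "M = M_bound n k \<epsilon> r"
  define R where "R = R_bound n k \<epsilon>"
  have "ln 2 \<le> lk" using k by (simp add: lk_def)
  with ln2_ge_two_thirds have lk: "2/3 \<le> lk" by linarith
  have "2 * (2/3) \<le> real k * lk" using k lk by (intro mult_mono) auto
  then have \<kappa>1: "1 \<le> \<kappa>" by (simp add: \<kappa>_def)
  have K1: "1 \<le> K" using r by (simp add: K_def)
  have Meq: "M = max ((K * (real n / \<epsilon>\<^sup>2)) powr (2/3)) (K * sqrt (real n) / \<epsilon>\<^sup>2)"
    by (simp add: M_def M_bound_def K_def mult.commute)
  have Req: "R = (if real n \<ge> \<kappa> / \<epsilon>^4 then ((real n)\<^sup>2 * \<kappa> / \<epsilon>^4) powr (1/3)
     else if real n \<ge> \<kappa> then sqrt (real n * \<kappa>) / \<epsilon>\<^sup>2 else \<kappa> / \<epsilon>\<^sup>2)"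
    by (simp add: R_def R_bound_def \<kappa>_def lk_def mult.assoc)
  obtain m1 s1 where p1: "1 \<le> m1" "m1 \<le> n" "10^13 * real n \<le> real s1 * sqrt (real m1) * \<epsilon>\<^sup>2"
    "real m1 \<le> 2 * M" "K * real s1 \<le> (10^13 + 1) * M"
    unfolding Meq by (rule find_parameters[OF n e K1])
  obtain m s t where p2: "1 \<le> m" "m \<le> n" "10^13 * real n \<le> real s * real m * \<epsilon>\<^sup>2"
    "10^13 * real n \<le> real t * real m * \<epsilon>\<^sup>2" "10^13 * (real n)\<^sup>2 \<le> real t * real s * real m * \<epsilon>^4"
    "real m \<le> 2 * R" "real s \<le> (10^13 + 1) * R" "\<kappa> * real t \<le> (10^13 + 1) * R"
    unfolding Req by (rule classify_parameters[OF n e \<kappa>1])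
  \<comment> \<open>Since \<open>2/3 \<le> ln 2\<close>, this makes \<open>2 ^ L\<close> at least
    \<open>k ^ 10\<close>, hence at least \<open>512 * k\<close>, enough for the union bounds over
    \<open>N\<close> and over \<open>k\<close> votes.\<close>
  define L where "L = nat \<lceil>15 * lk\<rceil>"
  \<comment> \<open>A random index hits \<open>J\<close> with probability at least
    \<open>r / k\<close>, so all of them miss it with probability at most \<open>exp (- 8)\<close>,
    which is below \<open>1/50\<close>.\<close>
  define N where "N = nat \<lceil>8 * K\<rceil>"
  have L: "15 * lk \<le> real L" "real L \<le> 17 * lk"
    using nat_ceiling_bounds[of "15 * lk", folded L_def] lk by auto
  have N: "8 * K \<le> real N" "real N \<le> 9 * K"
    using nat_ceiling_bounds[of "8 * K", folded N_def] K1 by auto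
  have M0: "0 \<le> M" using p1(4) by linarith
  have R0: "0 \<le> R" using p2(6) by linarith
  have LP: "512 * real k \<le> 2 ^ L"
  proof -
    have "(512::real) * real k = 2 ^ 9 * real k" by simp
    also have "\<dots> \<le> real k ^ 9 * real k" using k by (intro mult_right_mono power_mono) auto
    also have "\<dots> = real k ^ 10" by (simp flip: power_Suc2)
    also have "\<dots> = exp (10 * lk)" using k by (simp add: lk_def exp_of_nat_mult[of 10, simplified])
    also have "\<dots> \<le> exp (ln 2 * real L)"
    proof -
      have "10 * lk = 2/3 * (15 * lk)" by simp
      also have "\<dots> \<le> ln 2 * real L" using ln2_ge_two_thirds L(1) lk by (intro mult_mono) auto
      finally show ?thesis by simp
    qed
    also have "\<dots> = 2 ^ L" by (simp add: exp_of_nat2_mult)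
    finally show ?thesis .
  qed
  have Kk: "K \<le> real k" using r k by (simp add: K_def field_simps mult_left_le)
  have "real N * (1 / 2 ^ L) \<le> 9 * real k / 2 ^ L" using N(2) Kk by (simp add: divide_right_mono)
  also have "\<dots> \<le> 9/512" using LP by (simp add: field_simps)
  finally have vN: "real N * (1 / 2 ^ L) \<le> 9/512" .
  have vk: "real k * (1 / 2 ^ L) \<le> 1/512" using LP by (simp add: field_simps)
  let ?F = "find_and_classify L (\<epsilon>\<^sup>2 / (50 * real n)) N m1 s1 m s t k"
  let ?cost = "real m1 + real N * (real L * (4 * real s1)) + (real m + 2 * real s + 2 * real t + real k * (real L * real t))"
  have cost: "?cost \<le> 10^16 * (M * lk + R)"
  proof -
    have "M * (2/3) \<le> M * lk" using lk M0 by (intro mult_left_mono) auto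
    then have a: "real m1 \<le> 3 * (M * lk)" using p1(4) by linarith
    have "real N * (real L * (4 * real s1)) \<le> (9 * K) * ((17 * lk) * (4 * real s1))"
      using N L K1 lk by (intro mult_mono) auto
    also have "\<dots> = 612 * lk * (K * real s1)" by simp
    also have "\<dots> \<le> 612 * lk * ((10^13 + 1) * M)" using p1(5) lk by (intro mult_left_mono) auto
    finally have b: "real N * (real L * (4 * real s1)) \<le> 612 * (10^13 + 1) * (M * lk)" by (simp add: mult_ac)
    have "real t \<le> \<kappa> * real t" using mult_right_mono[OF \<kappa>1, of "real t"] by simp
    then have c: "real t \<le> (10^13 + 1) * R" using p2(8) by linarith
    have "real k * (real L * real t) \<le> real k * ((17 * lk) * real t)"
      using L by (intro mult_left_mono mult_right_mono) auto
    \<comment> \<open>The number of votes is absorbed here: \<open>\<kappa>\<close> already contains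
      \<open>ln k\<close>, so \<open>R\<close> needs no further logarithm.\<close>
    also have "\<dots> = 17 * (\<kappa> * real t)" by (simp add: \<kappa>_def)
    finally have d: "real k * (real L * real t) \<le> 17 * ((10^13 + 1) * R)" using p2(8) by linarith
    have "0 \<le> M * lk" using M0 lk by simp
    moreover have "?cost \<le> 3 * (M * lk) + 612 * (10^13 + 1) * (M * lk) +
        (2 * R + 2 * ((10^13 + 1) * R) + 2 * ((10^13 + 1) * R) + 17 * ((10^13 + 1) * R))"
      using a b c d p2(6,7) by linarith
    ultimately show ?thesis using R0 by simp
  qed
  obtain A where A: "\<And>D. run A D = ?F D" "samples_le A ?cost"
    using implementable_imp_alg[OF implementable_find_and_classify] by blast
  show ?thesis
  proof (rule that)
    show "samples_le A (10^16 * (M_bound n k \<epsilon> r * ln (real k) + R_bound n k \<epsilon>))"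
      using samples_le_mono[OF A(2) cost] by (simp add: M_def R_def lk_def)
    fix D :: "nat \<Rightarrow> nat pmf" and I J
    assume sup: "\<And>a. a < k \<Longrightarrow> set_pmf (D a) \<subseteq> {..<n}"
      and part: "I \<union> J = {0..<k}" "I \<inter> J = {}" "0 \<in> I" and cardJ: "r \<le> card J"
      and eqI: "\<And>a. a \<in> I \<Longrightarrow> D a = D 0" and eqJ: "\<And>a b. a \<in> J \<Longrightarrow> b \<in> J \<Longrightarrow> D a = D b"
      and far: "\<And>b. b \<in> J \<Longrightarrow> \<epsilon> \<le> dTV (D 0) (D b)"
    have J: "J \<noteq> {}" using cardJ r by auto
    have "card J \<le> card {0..<k}" using part(1) by (intro card_mono) auto
    then have Jk: "real (card J) / real k \<le> 1" using k by (simp add: divide_simps)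
    have "(1 - real (card J) / real k) ^ N \<le> exp (- (real (card J) / real k)) ^ N"
      using Jk exp_ge_add_one_self[of "- (real (card J) / real k)"] by (intro power_mono) auto
    also have "\<dots> = exp (- (real N * (real (card J) / real k)))" by (simp add: exp_of_nat_mult[symmetric])
    also have "\<dots> \<le> exp (- 8)"
    proof -
      have "8 = 8 * K * (real r / real k)" using r k by (simp add: K_def)
      also have "\<dots> \<le> real N * (real (card J) / real k)"
        using N(1) cardJ K1 by (intro mult_mono divide_right_mono) auto
      finally show ?thesis by simp
    qed
    also have "\<dots> \<le> 1/50"
    proof -
      have "(2::real) ^ 8 \<le> exp 1 ^ 8" using exp_ge_add_one_self[of 1] by (intro power_mono) auto
      also have "\<dots> = exp (8::real)" by (simp add: exp_of_nat_mult[of 8 1, simplified])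
      finally show ?thesis by (simp add: exp_minus field_simps)
    qed
    finally have miss: "(1 - real (card J) / real k) ^ N \<le> 1/50" .
    have "measure_pmf.prob (?F D) {R. R \<noteq> {I, J}} \<le>
      3/50 + (1/50 + (real N * (1 / 2 ^ L) + (3/50 + (1/32 + (1/64 + (real k * (1 / 2 ^ L) + 0))))))"
      by (rule find_and_classify_correct[where k = k and D = D, OF sup e p1(1,2) p2(1,2) p1(3) p2(3-5) part J eqI eqJ far miss])
    also have "\<dots> \<le> 1/3" using vN vk by linarith
    finally show "measure_pmf.prob (run A D) {R. R \<noteq> {I, J}} \<le> 1/3" by (simp add: A(1))
  qed
qed

theorem theoremC3:
  shows "\<exists>C::real. C > 0 \<and>
    (\<exists>A :: nat \<Rightarrow> nat \<Rightarrow> real \<Rightarrow> nat \<Rightarrow> alg.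
      \<forall>n k \<epsilon> D I1 I2. clustering_instance n k \<epsilon> D I1 I2 \<longrightarrow>
        (let r = min (card I1) (card I2) in
          measure_pmf.prob (run (A n k \<epsilon> r) D) {{I1, I2}} \<ge> 2/3 \<and>
          samples_le (A n k \<epsilon> r)
            (C * (M_bound n k \<epsilon> r * ln (real k) + R_bound n k \<epsilon>))))"
proof -
  \<comment> \<open>The tree is fixed before \<open>D\<close> and the partition, as it may depend on
    the four parameters only.\<close>
  have ex: "\<exists>A. \<forall>D I1 I2. clustering_instance n k \<epsilon> D I1 I2 \<and> r = min (card I1) (card I2) \<longrightarrow>
      measure_pmf.prob (run A D) {{I1, I2}} \<ge> 2/3 \<and>
      samples_le A (10^16 * (M_bound n k \<epsilon> r * ln (real k) + R_bound n k \<epsilon>))" for n k \<epsilon> r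
  \<comment> \<open>Parameters without an instance leave nothing to show; otherwise any instance
    certifies \<open>1 \<le> n\<close> and \<open>1 \<le> r \<le> k\<close>.\<close>
  proof (cases "\<exists>D I1 I2. clustering_instance n k \<epsilon> D I1 I2 \<and> r = min (card I1) (card I2)")
    case True
    then obtain D0 J1 J2 where i0: "clustering_instance n k \<epsilon> D0 J1 J2" and r0: "r = min (card J1) (card J2)"
      by blast
    have k: "2 \<le> k" and e: "0 < \<epsilon>" "\<epsilon> \<le> 1" using i0 by (auto simp: clustering_instance_def)
    have sub: "J1 \<subseteq> {0..<k}" "J2 \<subseteq> {0..<k}" "J1 \<noteq> {}" "J2 \<noteq> {}"
      using i0 unfolding clustering_instance_def by blast+
    then have fin: "finite J1" "finite J2" using finite_subset by blast+
    have r: "1 \<le> r" "r \<le> k"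
      using fin sub card_mono[OF _ sub(1)] by (auto simp: r0 Suc_le_eq card_gt_0_iff min_le_iff_disj)
    have "set_pmf (D0 0) \<subseteq> {0..<n}" using i0 k by (auto simp: clustering_instance_def)
    then have n: "1 \<le> n" using set_pmf_not_empty[of "D0 0"] by (cases n) auto
    obtain A where A: "samples_le A (10^16 * (M_bound n k \<epsilon> r * ln (real k) + R_bound n k \<epsilon>))"
      "\<And>D I J. \<lbrakk>\<And>a. a < k \<Longrightarrow> set_pmf (D a) \<subseteq> {..<n}; I \<union> J = {0..<k}; I \<inter> J = {}; 0 \<in> I; r \<le> card J;
        \<And>a. a \<in> I \<Longrightarrow> D a = D 0; \<And>a b. a \<in> J \<Longrightarrow> b \<in> J \<Longrightarrow> D a = D b;
        \<And>b. b \<in> J \<Longrightarrow> \<epsilon> \<le> dTV (D 0) (D b)\<rbrakk> \<Longrightarrow>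
        measure_pmf.prob (run A D) {R. R \<noteq> {I, J}} \<le> 1/3"
      using clustering_alg_exists[OF n k r e] by blast
    have "measure_pmf.prob (run A D) {{I1, I2}} \<ge> 2/3"
      if i: "clustering_instance n k \<epsilon> D I1 I2" and rI: "r = min (card I1) (card I2)" for D I1 I2
    proof -
      have sup: "set_pmf (D a) \<subseteq> {..<n}" if "a < k" for a
        using i that by (simp add: clustering_instance_def atLeast0LessThan)
      have un: "I1 \<union> I2 = {0..<k}" "I1 \<inter> I2 = {}" using i by (auto simp: clustering_instance_def)
      have eq1: "D a = D b" if "a \<in> I1" "b \<in> I1" for a b using i that unfolding clustering_instance_def by blast
      have eq2: "D a = D b" if "a \<in> I2" "b \<in> I2" for a b using i that unfolding clustering_instance_def by blast
      have far: "\<epsilon> \<le> dTV (D a) (D b)" if "a \<in> I1" "b \<in> I2" for a b using i that unfolding clustering_instance_def by blast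
      have sym: "dTV (D a) (D b) = dTV (D b) (D a)" for a b by (simp add: dTV_def abs_minus_commute)
      \<comment> \<open>Either block may contain index \<open>0\<close>; the output is an unordered
        pair, so exchanging the blocks is harmless.\<close>
      have "0 \<in> I1 \<union> I2" unfolding un using k by simp
      then have "measure_pmf.prob (run A D) {R. R \<noteq> {I1, I2}} \<le> 1/3"
      proof
        assume 0: "0 \<in> I1"
        show ?thesis
          using rI by (intro A(2)[of D I1 I2, OF sup un 0 _ eq1[OF _ 0] eq2 far[OF 0]]) simp_all
      next
        assume 0: "0 \<in> I2"
        have un': "I2 \<union> I1 = {0..<k}" "I2 \<inter> I1 = {}" using un by (simp_all add: Un_commute Int_commute)
        have far': "\<epsilon> \<le> dTV (D 0) (D b)" if "b \<in> I1" for b using far[OF that 0] sym by metis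
        have "measure_pmf.prob (run A D) {R. R \<noteq> {I2, I1}} \<le> 1/3"
          using rI by (intro A(2)[of D I2 I1, OF sup un' 0 _ eq2[OF _ 0] eq1 far']) simp_all
        then show ?thesis by (simp add: insert_commute)
      qed
      moreover have "{R. R \<noteq> {I1, I2}} = UNIV - {{I1, I2}}" by auto
      ultimately show ?thesis
        using measure_pmf.prob_compl[of "{{I1, I2}}" "run A D"] by simp
    qed
    then show ?thesis using A(1) by blast
  qed blast
  then obtain A where "\<And>n k \<epsilon> r D I1 I2. clustering_instance n k \<epsilon> D I1 I2 \<Longrightarrow> r = min (card I1) (card I2) \<Longrightarrow>
      measure_pmf.prob (run (A n k \<epsilon> r) D) {{I1, I2}} \<ge> 2/3 \<and>
      samples_le (A n k \<epsilon> r) (10^16 * (M_bound n k \<epsilon> r * ln (real k) + R_bound n k \<epsilon>))"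
    by metis
  then show ?thesis
    by (intro exI[of _ "10^16"] conjI exI[of _ A]) (auto simp: Let_def)
qed

end
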